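(* Let $s>\mu_{obs}$, $\theta=sm-n$, $F\in\mathbb{R}^{p\times n}$, $L\in\mathbb{R}^{n\times m}$, and let $K_{G,s}\in\mathbb{R}^{\theta\times s(p+m)}$. Then $$K_{G,s}I_{G,s}(F)=0\quad\text{and}\quad\operatorname{rank}\big(K_{G,s}I_{C,s}(F,L)\big)=\theta$$ hold if and only if $K_{G,s}=K_2\,[\,-\mathcal{T}_{s,s}(G)\ \ I_{sm}\,]$ for some $K_2\in\mathbb{R}^{\theta\times sm}$ with $K_2\mathcal{O}_s=0$ and $\operatorname{rank}K_2=\theta$. In that case, for every solution $(u,y,r,\hat x)$ of the kernel-based model with gain $L$ on an interval containing $[k-n+1,k+s]$, the residual $r_K(k):=K_{G,s}\begin{bmatrix}u_s(k)\\ y_s(k)\end{bmatrix}$ satisfies $r_K(k)=K_2\,\bar r_s(k)$, where $\bar r_s(k)$ is the vector of the last $sm$ entries of $R_{s+n}r_{s+n}(k-n)$, and $R_{s+n}\in\mathbb{R}^{(s+n)m\times(s+n)m}$ is block lower-triangular Toeplitz with $(i,j)$ block $CA^{i-j-1}L$ ($i>j$), $I_m$ ($i=j$), $0$ ($i<j$).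
   Context: Consider the discrete-time LTI system $x(k+1)=Ax(k)+Bu(k)$, $y(k)=Cx(k)+Du(k)$ with $u\in\mathbb{R}^p$, $x\in\mathbb{R}^n$, $y\in\mathbb{R}^m$, $n\ge 1$, and $(A,B,C,D)$ a minimal (controllable and observable) realization. For a sequence $\phi$, $\phi_s(k)=[\phi(k+1)^T,\dots,\phi(k+s)^T]^T$. $\mathcal{O}_s=[C^T,(CA)^T,\dots,(CA^{s-1})^T]^T$; $\mu_{obs}$ is the smallest integer $\nu$ with $\operatorname{rank}\mathcal{O}_\nu=n$. $\mathcal{T}_{s,s}(G)\in\mathbb{R}^{sm\times sp}$ is block lower-triangular Toeplitz with $(i,j)$ block $CA^{i-j-1}B$ ($i>j$), $D$ ($i=j$), $0$ ($i<j$). For $F\in\mathbb{R}^{p\times n}$, $A_F=A+BF$, $C_F=C+DF$. Kernel-based model with gain $L$: $\hat x(k+1)=A\hat x(k)+Bu(k)+Lr(k)$, $y(k)=C\hat x(k)+Du(k)+r(k)$. Finite-sample image representation: $M_s(F)\in\mathbb{R}^{sp\times(s+n)p}$, $N_s(F)\in\mathbb{R}^{sm\times(s+n)p}$ with $(l,j)$ blocks ($l=1,\dots,s$; $j=1,\dots,s+n$) $M_{n+l-j}$, $N_{n+l-j}$, where $M_k=FA_F^{k-1}B$ ($k\ge1$), $M_0=I_p$, $M_k=0$ ($k<0$), $N_k=C_FA_F^{k-1}B$ ($k\ge1$), $N_0=D$, $N_k=0$ ($k<0$); $I_{G,s}(F)=\begin{bmatrix}M_s(F)\\ N_s(F)\end{bmatrix}$.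 For gains $F,L$: $\hat Y_s(F,L)$, $\hat X_s(F,L)$ with $(l,j)$ blocks $\hat Y_{n+l-j}$, $\hat X_{n+l-j}$, where $\hat Y_k=FA_F^{k-1}L$ ($k\ge1$), $\hat Y_k=0$ ($k\le0$), $\hat X_k=C_FA_F^{k-1}L$ ($k\ge1$), $\hat X_0=I_m$, $\hat X_k=0$ ($k<0$); $I_{C,s}(F,L)=\begin{bmatrix}\hat Y_s(F,L)\\ \hat X_s(F,L)\end{bmatrix}$. *)

theory Defs
  imports "Jordan_Normal_Form.DL_Rank"
begin

abbreviation mrank :: "nat \<Rightarrow> real mat \<Rightarrow> nat" where
  "mrank nr M \<equiv> vec_space.rank nr M"

definition blockmat :: "nat \<Rightarrow> nat \<Rightarrow> nat \<Rightarrow> nat \<Rightarrow> (nat \<Rightarrow> nat \<Rightarrow> real mat) \<Rightarrow> real mat" where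
  "blockmat r c nbr nbc f = mat (nbr * r) (nbc * c)
     (\<lambda>(i,j). f (i div r) (j div c) $$ (i mod r, j mod c))"

definition stackv :: "nat \<Rightarrow> nat \<Rightarrow> (int \<Rightarrow> real vec) \<Rightarrow> int \<Rightarrow> real vec" where
  "stackv d s phi k = vec (s * d) (\<lambda>i. phi (k + 1 + int (i div d)) $ (i mod d))"

definition obsv :: "nat \<Rightarrow> nat \<Rightarrow> real mat \<Rightarrow> real mat \<Rightarrow> nat \<Rightarrow> real mat" where
  "obsv n m A C s = blockmat m n s 1 (\<lambda>i j. C * A ^\<^sub>m i)"

definition ctrb :: "nat \<Rightarrow> nat \<Rightarrow> real mat \<Rightarrow> real mat \<Rightarrow> real mat" where
  "ctrb n p A B = blockmat n p 1 n (\<lambda>i j. A ^\<^sub>m j * B)"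

definition mu_obs :: "nat \<Rightarrow> nat \<Rightarrow> real mat \<Rightarrow> real mat \<Rightarrow> nat" where
  "mu_obs n m A C = (LEAST \<nu>. mrank (\<nu> * m) (obsv n m A C \<nu>) = n)"

definition toeplitz :: "nat \<Rightarrow> nat \<Rightarrow> real mat \<Rightarrow> real mat \<Rightarrow> real mat \<Rightarrow> real mat \<Rightarrow> nat \<Rightarrow> real mat" where
  "toeplitz m p A B C D s = blockmat m p s s
     (\<lambda>i j. if j < i then C * A ^\<^sub>m (i - j - 1) * B else if i = j then D else 0\<^sub>m m p)"

definition kerfac :: "nat \<Rightarrow> nat \<Rightarrow> real mat \<Rightarrow> real mat \<Rightarrow> real mat \<Rightarrow> real mat \<Rightarrow> nat \<Rightarrow> real mat" where
  "kerfac m p A B C D s = mat (s * m) (s * p + s * m)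
     (\<lambda>(i,j). if j < s * p then - (toeplitz m p A B C D s $$ (i, j))
             else if i = j - s * p then 1 else 0)"

definition Mk :: "nat \<Rightarrow> real mat \<Rightarrow> real mat \<Rightarrow> real mat \<Rightarrow> int \<Rightarrow> real mat" where
  "Mk p A B F k = (if k \<ge> 1 then F * (A + B * F) ^\<^sub>m nat (k - 1) * B
                   else if k = 0 then 1\<^sub>m p else 0\<^sub>m p p)"

definition Nk :: "nat \<Rightarrow> nat \<Rightarrow> real mat \<Rightarrow> real mat \<Rightarrow> real mat \<Rightarrow> real mat \<Rightarrow> real mat \<Rightarrow> int \<Rightarrow> real mat" where
  "Nk m p A B C D F k = (if k \<ge> 1 then (C + D * F) * (A + B * F) ^\<^sub>m nat (k - 1) * B
                   else if k = 0 then D else 0\<^sub>m m p)"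

definition Yk :: "nat \<Rightarrow> nat \<Rightarrow> real mat \<Rightarrow> real mat \<Rightarrow> real mat \<Rightarrow> real mat \<Rightarrow> int \<Rightarrow> real mat" where
  "Yk m p A B F L k = (if k \<ge> 1 then F * (A + B * F) ^\<^sub>m nat (k - 1) * L else 0\<^sub>m p m)"

definition Xk :: "nat \<Rightarrow> real mat \<Rightarrow> real mat \<Rightarrow> real mat \<Rightarrow> real mat \<Rightarrow> real mat \<Rightarrow> real mat \<Rightarrow> int \<Rightarrow> real mat" where
  "Xk m A B C D F L k = (if k \<ge> 1 then (C + D * F) * (A + B * F) ^\<^sub>m nat (k - 1) * L
                   else if k = 0 then 1\<^sub>m m else 0\<^sub>m m m)"

definition IG :: "nat \<Rightarrow> nat \<Rightarrow> nat \<Rightarrow> real mat \<Rightarrow> real mat \<Rightarrow> real mat \<Rightarrow> real mat \<Rightarrow> real mat \<Rightarrow> nat \<Rightarrow> real mat" where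
  "IG n m p A B C D F s =
     blockmat p p s (s + n) (\<lambda>l j. Mk p A B F (int n + int l - int j))
     @\<^sub>r blockmat m p s (s + n) (\<lambda>l j. Nk m p A B C D F (int n + int l - int j))"

definition IC :: "nat \<Rightarrow> nat \<Rightarrow> nat \<Rightarrow> real mat \<Rightarrow> real mat \<Rightarrow> real mat \<Rightarrow> real mat \<Rightarrow> real mat \<Rightarrow> real mat \<Rightarrow> nat \<Rightarrow> real mat" where
  "IC n m p A B C D F L s =
     blockmat p m s (s + n) (\<lambda>l j. Yk m p A B F L (int n + int l - int j))
     @\<^sub>r blockmat m m s (s + n) (\<lambda>l j. Xk m A B C D F L (int n + int l - int j))"

definition Rmat :: "nat \<Rightarrow> real mat \<Rightarrow> real mat \<Rightarrow> real mat \<Rightarrow> nat \<Rightarrow> real mat" where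
  "Rmat m A C L N = blockmat m m N N
     (\<lambda>i j. if j < i then C * A ^\<^sub>m (i - j - 1) * L else if i = j then 1\<^sub>m m else 0\<^sub>m m m)"

definition kbm_solution :: "real mat \<Rightarrow> real mat \<Rightarrow> real mat \<Rightarrow> real mat \<Rightarrow> real mat \<Rightarrow>
    (int \<Rightarrow> real vec) \<Rightarrow> (int \<Rightarrow> real vec) \<Rightarrow> (int \<Rightarrow> real vec) \<Rightarrow> (int \<Rightarrow> real vec) \<Rightarrow> int set \<Rightarrow> bool" where
  "kbm_solution A B C D L u y r xh I \<longleftrightarrow>
     (\<forall>j\<in>I. y j = C *\<^sub>v xh j + D *\<^sub>v u j + r j) \<and>
     (\<forall>j. j \<in> I \<longrightarrow> j + 1 \<in> I \<longrightarrow> xh (j + 1) = A *\<^sub>v xh j + B *\<^sub>v u j + L *\<^sub>v r j)"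

definition int_interval :: "int set \<Rightarrow> bool" where
  "int_interval I \<longleftrightarrow> (\<forall>a\<in>I. \<forall>c\<in>I. \<forall>b. a \<le> b \<longrightarrow> b \<le> c \<longrightarrow> b \<in> I)"

end

theory Submission
  imports Defs
begin

text \<open>
  Full row rank is the same as surjectivity, so everything can be checked on trajectories.
  The matrix \<open>[-T I]\<close> maps a stacked trajectory \<open>(u, y)\<close> of the kernel-based model to
  \<open>O x\<^sub>0 + R r\<close>, where \<open>x\<^sub>0\<close> is the state at the start of the window. The columns of \<open>I\<^sub>G\<close> and
  \<open>I\<^sub>C\<close> are such trajectories, with \<open>r = 0\<close> and \<open>r\<close> free respectively. Since controllability is
  invariant under state feedback and \<open>n\<close> steps precede the window, \<open>I\<^sub>G\<close> produces every input together
  with every initial state; hence \<open>K I\<^sub>G = 0\<close> means \<open>K = K\<^sub>2 [-T I]\<close> with \<open>K\<^sub>2 O = 0\<close>. Then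
  \<open>K I\<^sub>C = K\<^sub>2 [0 R]\<close>, and \<open>R\<close> is unit block lower triangular, so \<open>K I\<^sub>C\<close> has full row rank
  exactly when \<open>K\<^sub>2\<close> does.
\<close>

section \<open>Full row rank\<close>

text \<open>The rank is the dimension of the column span, and a subspace of full dimension is the
  whole space. Through this equivalence both rank conditions of the theorem become solvability of
  linear equations.\<close>

lemma (in vec_space) full_row_rank_iff_surj:
  assumes M: "M \<in> carrier_mat n nc"
  shows "rank M = n \<longleftrightarrow> (\<forall>b\<in>carrier_vec n. \<exists>x\<in>carrier_vec nc. M *\<^sub>v x = b)"
proof -
  have cols: "set (cols M) \<subseteq> carrier_vec n"
    using M cols_dim by blast
  have "rank M = n \<longleftrightarrow> span (set (cols M)) = carrier_vec n"
  proof
    assume r: "rank M = n"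
    \<comment> \<open>A maximal independent set of columns realises the rank, so here it has
      \<open>n\<close> elements and is a basis.\<close>
    obtain S where S: "maximal S (\<lambda>T. T \<subseteq> set (cols M) \<and> lin_indpt T)"
      using maximal_exists_superset[of "set (cols M)" "\<lambda>T. T \<subseteq> set (cols M) \<and> lin_indpt T" "{}"]
      by (auto simp: lin_dep_def)
    have li: "lin_indpt S" and sub: "S \<subseteq> set (cols M)"
      using S by (auto simp: maximal_def)
    have "card S = n" using rank_card_indpt[OF M S] r by simp
    then have "basis S"
      using li sub cols finite_subset[OF sub]
      by (intro dim_li_is_basis) (auto simp: dim_is_n)
    then have "span S = carrier_vec n" by (simp add: basis_def)
    moreover have "span S \<subseteq> span (set (cols M))" by (rule span_is_monotone[OF sub])
    moreover have "span (set (cols M)) \<subseteq> carrier_vec n" using cols span_closed by auto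
    ultimately show "span (set (cols M)) = carrier_vec n" by blast
  next
    assume "span (set (cols M)) = carrier_vec n"
    then have "span_vs (set (cols M)) = V" by (simp add: module_vec_def)
    then show "rank M = n" by (simp add: rank_def dim_is_n)
  qed
  then show ?thesis
    using col_space_eq[OF M] M unfolding col_space_def by auto
qed

text \<open>Unit vectors recover the columns. Matrix equations about \<open>K\<close> can thus be
  verified on single trajectories.\<close>

lemma mat_eqI_mult_vec:
  fixes P Q :: "'a::semiring_1 mat"
  assumes P: "P \<in> carrier_mat nr nc" and Q: "Q \<in> carrier_mat nr nc"
    and eq: "\<And>v. v \<in> carrier_vec nc \<Longrightarrow> P *\<^sub>v v = Q *\<^sub>v v"
  shows "P = Q"
proof (rule eq_matI)
  fix i j assume ij: "i < dim_row Q" "j < dim_col Q"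
  have "(P *\<^sub>v unit_vec nc j) $ i = (Q *\<^sub>v unit_vec nc j) $ i" by (simp add: eq)
  then show "P $$ (i, j) = Q $$ (i, j)" using P Q ij by (auto simp: row_def)
qed (use P Q in auto)

section \<open>Stacked vectors and block matrices\<close>

text \<open>Time starts at zero here, so that one set of lemmas serves every window;
  \<open>stackv\<close> is the case of a signal shifted by \<open>k + 1\<close>.\<close>

definition stack :: "nat \<Rightarrow> nat \<Rightarrow> (nat \<Rightarrow> real vec) \<Rightarrow> real vec" where
  "stack d N \<phi> = vec (N * d) (\<lambda>i. \<phi> (i div d) $ (i mod d))"

text \<open>Inverse of \<open>stack\<close>: cuts a vector of length \<open>N * d\<close> back into
  a signal.\<close>

definition block :: "nat \<Rightarrow> real vec \<Rightarrow> nat \<Rightarrow> real vec" where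
  "block d w t = vec d (\<lambda>i. w $ (t * d + i))"

text \<open>The dimension is an explicit argument because the empty sum must be a zero vector of
  definite length, which the type does not determine.\<close>

fun vsum :: "nat \<Rightarrow> nat \<Rightarrow> (nat \<Rightarrow> real vec) \<Rightarrow> real vec" where
  "vsum d 0 g = 0\<^sub>v d"
| "vsum d (Suc N) g = vsum d N g + g N"

lemma stack_carrier [simp]: "stack d N \<phi> \<in> carrier_vec (N * d)"
  by (simp add: stack_def)

lemma block_carrier [simp]: "block d w t \<in> carrier_vec d"
  by (simp add: block_def)

lemma stackv_eq_stack: "stackv d N \<phi> k = stack d N (\<lambda>t. \<phi> (k + 1 + int t))"
  by (simp add: stackv_def stack_def)

lemma stack_index_bounds:
  fixes i :: nat assumes "i < N * d" shows "i div d < N" "i mod d < d"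
proof -
  show "i div d < N" using assms by (simp add: less_mult_imp_div_less)
  have "d > 0" using assms by (cases d) auto
  then show "i mod d < d" by simp
qed

lemma stack_block: "w \<in> carrier_vec (N * d) \<Longrightarrow> stack d N (block d w) = w"
  by (intro eq_vecI) (auto simp: stack_def block_def stack_index_bounds)

lemma stack_single: "v \<in> carrier_vec d \<Longrightarrow> stack d 1 (\<lambda>_. v) = v"
  by (intro eq_vecI) (auto simp: stack_def)

lemma stack_cong: "(\<And>t. t < N \<Longrightarrow> \<phi> t = \<psi> t) \<Longrightarrow> stack d N \<phi> = stack d N \<psi>"
  by (intro eq_vecI) (auto simp: stack_def stack_index_bounds)

lemma stack_add:
  assumes "\<And>t. t < N \<Longrightarrow> \<phi> t \<in> carrier_vec d" "\<And>t. t < N \<Longrightarrow> \<psi> t \<in> carrier_vec d"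
  shows "stack d N (\<lambda>t. \<phi> t + \<psi> t) = stack d N \<phi> + stack d N \<psi>"
proof (intro eq_vecI)
  fix i assume "i < dim_vec (stack d N \<phi> + stack d N \<psi>)"
  then have i: "i < N * d" by (simp add: stack_def)
  note b = stack_index_bounds[OF i]
  show "stack d N (\<lambda>t. \<phi> t + \<psi> t) $ i = (stack d N \<phi> + stack d N \<psi>) $ i"
    using assms[OF b(1)] b i by (simp add: stack_def)
qed (simp add: stack_def)

lemma vsum_carrier [simp]: "(\<And>j. j < N \<Longrightarrow> g j \<in> carrier_vec d) \<Longrightarrow> vsum d N g \<in> carrier_vec d"
  by (induction N) auto

lemma vsum_index:
  "(\<And>j. j < N \<Longrightarrow> g j \<in> carrier_vec d) \<Longrightarrow> i < d \<Longrightarrow> vsum d N g $ i = (\<Sum>j<N. g j $ i)"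
proof (induction N)
  case (Suc N)
  have "dim_vec (g N) = d" using Suc.prems(1)[of N] by (simp add: carrier_vecD)
  then have "(vsum d N g + g N) $ i = vsum d N g $ i + g N $ i"
    using Suc.prems(2) by simp
  then show ?case using Suc by simp
qed simp

lemma vsum_cong: "(\<And>j. j < N \<Longrightarrow> g j = h j) \<Longrightarrow> vsum d N g = vsum d N h"
  by (induction N) auto

text \<open>Serves causality: blocks above the diagonal contribute zero vectors, so a sum over the
  whole window stops at the current time.\<close>

lemma vsum_truncate:
  assumes "K \<le> N" "\<And>j. j < K \<Longrightarrow> g j \<in> carrier_vec d" "\<And>j. K \<le> j \<Longrightarrow> j < N \<Longrightarrow> g j = 0\<^sub>v d"
  shows "vsum d N g = vsum d K g"
  using assms
proof (induction rule: dec_induct)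
  case (step N)
  then show ?case by simp
qed simp

lemma mult_mat_vsum:
  assumes M: "M \<in> carrier_mat nr d" and g: "\<And>j. j < N \<Longrightarrow> g j \<in> carrier_vec d"
  shows "M *\<^sub>v vsum d N g = vsum nr N (\<lambda>j. M *\<^sub>v g j)"
  using g
proof (induction N)
  case 0 then show ?case using M by (intro eq_vecI) auto
next
  case (Suc N)
  then show ?case using M by (simp add: mult_add_distrib_mat_vec[OF M])
qed

text \<open>Reconciles \<open>ctrb\<close>, whose columns have ascending powers of \<open>A\<close>,
  with the state formula, where later inputs carry lower powers.\<close>

lemma vsum_reverse:
  assumes "\<And>j. j < N \<Longrightarrow> g j \<in> carrier_vec d"
  shows "vsum d N (\<lambda>j. g (N - 1 - j)) = vsum d N g"
proof (intro eq_vecI)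
  have c: "\<And>j. j < N \<Longrightarrow> g (N - 1 - j) \<in> carrier_vec d" using assms by simp
  have dims: "dim_vec (vsum d N g) = d" "dim_vec (vsum d N (\<lambda>j. g (N - 1 - j))) = d"
    using vsum_carrier[of N g d] vsum_carrier[of N "\<lambda>j. g (N - 1 - j)" d] assms c by auto
  then show "dim_vec (vsum d N (\<lambda>j. g (N - 1 - j))) = dim_vec (vsum d N g)" by simp
  fix i assume "i < dim_vec (vsum d N g)"
  then have "i < d" using dims by simp
  then show "vsum d N (\<lambda>j. g (N - 1 - j)) $ i = vsum d N g $ i"
    using assms c by (simp add: vsum_index sum.nat_diff_reindex[of "\<lambda>j. g j $ i"])
qed

lemma sum_blocks:
  fixes f :: "nat \<Rightarrow> 'a::comm_monoid_add"
  shows "(\<Sum>i<N * d. f i) = (\<Sum>t<N. \<Sum>i<d. f (t * d + i))"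
proof (induction N)
  case (Suc N)
  have "(\<Sum>i<a + d. f i) = (\<Sum>i<a. f i) + (\<Sum>i<d. f (a + i))" for a
    by (induction d) (auto simp: add.assoc)
  from this[of "N * d"] show ?case using Suc by (simp add: add.commute)
qed simp

section \<open>Block matrices acting on stacked signals\<close>

lemma blockmat_carrier [simp]: "blockmat r c nr nc f \<in> carrier_mat (nr * r) (nc * c)"
  by (simp add: blockmat_def)

text \<open>The scalar product with a row is regrouped by blocks. This reduces products with block
  matrices to convolution sums of vectors.\<close>

lemma blockmat_mult_stack:
  assumes f: "\<And>l j. l < nr \<Longrightarrow> j < nc \<Longrightarrow> f l j \<in> carrier_mat r c"
    and \<phi>: "\<And>j. j < nc \<Longrightarrow> \<phi> j \<in> carrier_vec c"
  shows "blockmat r c nr nc f *\<^sub>v stack c nc \<phi> = stack r nr (\<lambda>l. vsum r nc (\<lambda>j. f l j *\<^sub>v \<phi> j))"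
proof (intro eq_vecI)
  fix i assume "i < dim_vec (stack r nr (\<lambda>l. vsum r nc (\<lambda>j. f l j *\<^sub>v \<phi> j)))"
  then have i: "i < nr * r" by (simp add: stack_def)
  note b = stack_index_bounds[OF i]
  let ?l = "i div r" and ?i = "i mod r"
  have "(blockmat r c nr nc f *\<^sub>v stack c nc \<phi>) $ i
      = (\<Sum>q<nc * c. f ?l (q div c) $$ (?i, q mod c) * \<phi> (q div c) $ (q mod c))"
    using i by (simp add: blockmat_def stack_def scalar_prod_def lessThan_atLeast0)
  also have "\<dots> = (\<Sum>j<nc. \<Sum>q<c. f ?l j $$ (?i, q) * \<phi> j $ q)"
    by (auto simp: sum_blocks intro!: sum.cong)
  also have "\<dots> = (\<Sum>j<nc. (f ?l j *\<^sub>v \<phi> j) $ ?i)"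
  proof (intro sum.cong refl)
    fix j assume "j \<in> {..<nc}"
    then have "f ?l j \<in> carrier_mat r c" "\<phi> j \<in> carrier_vec c" using f \<phi> b by auto
    then show "(\<Sum>q<c. f ?l j $$ (?i, q) * \<phi> j $ q) = (f ?l j *\<^sub>v \<phi> j) $ ?i"
      using b by (auto simp: scalar_prod_def lessThan_atLeast0)
  qed
  also have "\<dots> = vsum r nc (\<lambda>j. f ?l j *\<^sub>v \<phi> j) $ ?i"
    using b f[OF b(1)] \<phi> by (subst vsum_index) (auto intro!: mult_mat_vec_carrier)
  finally show "(blockmat r c nr nc f *\<^sub>v stack c nc \<phi>) $ i
      = stack r nr (\<lambda>l. vsum r nc (\<lambda>j. f l j *\<^sub>v \<phi> j)) $ i"
    using i by (simp add: stack_def)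
qed (simp add: stack_def blockmat_def)


section \<open>Responses of linear systems\<close>

text \<open>Impulse response from time \<open>j\<close> to time \<open>i\<close>. Row and column
  index are kept separate so that rows \<open>n + l\<close> of the same kernel also describe the
  delayed blocks of \<open>IG\<close> and \<open>IC\<close>.\<close>

definition markov :: "nat \<Rightarrow> nat \<Rightarrow> real mat \<Rightarrow> real mat \<Rightarrow> real mat \<Rightarrow> real mat \<Rightarrow> nat \<Rightarrow> nat \<Rightarrow> real mat" where
  "markov m p A B C D i j =
     (if j < i then C * A ^\<^sub>m (i - j - 1) * B else if i = j then D else 0\<^sub>m m p)"

lemma toeplitz_markov: "toeplitz m p A B C D N = blockmat m p N N (markov m p A B C D)"
  by (simp add: toeplitz_def markov_def[abs_def])

text \<open>Residuals act as the input of the system \<open>(A, L, C, I)\<close>, so the results on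
  Toeplitz responses cover \<open>R\<close> as well.\<close>

lemma Rmat_eq_toeplitz: "Rmat m A C L N = toeplitz m m A L C (1\<^sub>m m) N"
  by (simp add: toeplitz_def Rmat_def)

lemma toeplitz_carrier [simp]: "toeplitz m p A B C D N \<in> carrier_mat (N * m) (N * p)"
  by (simp add: toeplitz_def)

lemma Rmat_carrier [simp]: "Rmat m A C L N \<in> carrier_mat (N * m) (N * m)"
  by (simp add: Rmat_def)

lemma obsv_carrier [simp]: "obsv n m A C N \<in> carrier_mat (N * m) n"
  using blockmat_carrier[of m n N 1] by (simp add: obsv_def)

lemma ctrb_carrier [simp]: "ctrb n p A B \<in> carrier_mat n (n * p)"
  using blockmat_carrier[of n p 1 n] by (simp add: ctrb_def)

lemma IG_carrier [simp]: "IG n m p A B C D F s \<in> carrier_mat (s * p + s * m) ((s + n) * p)"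
  unfolding IG_def by (intro carrier_append_rows blockmat_carrier)

lemma IC_carrier [simp]: "IC n m p A B C D F L s \<in> carrier_mat (s * p + s * m) ((s + n) * m)"
  unfolding IC_def by (intro carrier_append_rows blockmat_carrier)

lemma kerfac_carrier [simp]: "kerfac m p A B C D s \<in> carrier_mat (s * m) (s * p + s * m)"
  by (simp add: kerfac_def)

section \<open>State and output formulas\<close>

lemma mult_mat_zero_vec [simp]: "M \<in> carrier_mat nr nc \<Longrightarrow> M *\<^sub>v 0\<^sub>v nc = (0\<^sub>v nr :: real vec)"
  by (intro eq_vecI) auto

lemma zero_mat_mult_vec [simp]: "v \<in> carrier_vec nc \<Longrightarrow> 0\<^sub>m nr nc *\<^sub>v v = (0\<^sub>v nr :: real vec)"
  by (intro eq_vecI) auto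

text \<open>Powers grow by a factor on the right, whereas the state recursion applies
  \<open>A\<close> on the left; hence the induction over all \<open>v\<close>.\<close>

lemma pow_mat_Suc_mult_vec:
  assumes A: "(A :: real mat) \<in> carrier_mat n n" and v: "v \<in> carrier_vec n"
  shows "A ^\<^sub>m Suc k *\<^sub>v v = A *\<^sub>v (A ^\<^sub>m k *\<^sub>v v)"
  using v
proof (induction k arbitrary: v)
  case 0 then show ?case using A by simp
next
  case (Suc k)
  have Av: "A *\<^sub>v v \<in> carrier_vec n" using A Suc.prems by simp
  have "A ^\<^sub>m Suc (Suc k) *\<^sub>v v = (A ^\<^sub>m Suc k * A) *\<^sub>v v" by simp
  also have "\<dots> = A ^\<^sub>m Suc k *\<^sub>v (A *\<^sub>v v)"
    by (rule assoc_mult_mat_vec[OF pow_carrier_mat[OF A] A Suc.prems])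
  also have "\<dots> = A *\<^sub>v (A ^\<^sub>m k *\<^sub>v (A *\<^sub>v v))" by (rule Suc.IH[OF Av])
  also have "A ^\<^sub>m k *\<^sub>v (A *\<^sub>v v) = (A ^\<^sub>m k * A) *\<^sub>v v"
    by (rule assoc_mult_mat_vec[OF pow_carrier_mat[OF A] A Suc.prems, symmetric])
  also have "A ^\<^sub>m k * A = A ^\<^sub>m Suc k" by simp
  finally show ?case .
qed

text \<open>Supplies witnesses with prescribed start and input. The response lemmas are instead
  about any signal that satisfies the recursion on a window.\<close>

primrec traj :: "real mat \<Rightarrow> real mat \<Rightarrow> real vec \<Rightarrow> (nat \<Rightarrow> real vec) \<Rightarrow> nat \<Rightarrow> real vec" where
  "traj A B x0 u 0 = x0"
| "traj A B x0 u (Suc t) = A *\<^sub>v traj A B x0 u t + B *\<^sub>v u t"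

text \<open>A sum of vectors takes its dimension from the second summand, here a product with
  \<open>B\<close>.\<close>

lemma traj_carrier [simp]:
  assumes "B \<in> carrier_mat n p" "x0 \<in> carrier_vec n"
  shows "traj A B x0 u t \<in> carrier_vec n"
proof (cases t)
  case (Suc k)
  then show ?thesis using carrier_matD(1)[OF assms(1)] by (intro carrier_vecI) simp
qed (use assms in simp)

lemma traj_cong: "(\<And>j. j < t \<Longrightarrow> u j = v j) \<Longrightarrow> traj A B x0 u t = traj A B x0 v t"
  by (induction t) auto

text \<open>Variation of constants, by induction: one more application of \<open>A\<close> raises
  every exponent, and the newest input enters with exponent zero.\<close>

lemma state_formula:
  assumes A: "A \<in> carrier_mat n n" and B: "B \<in> carrier_mat n p"
    and x0: "x 0 \<in> carrier_vec n" and u: "\<And>t. t < N \<Longrightarrow> u t \<in> carrier_vec p"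
    and x: "\<And>t. t < N \<Longrightarrow> x (Suc t) = A *\<^sub>v x t + B *\<^sub>v u t"
  shows "t \<le> N \<Longrightarrow> x t = A ^\<^sub>m t *\<^sub>v x 0 + vsum n t (\<lambda>j. A ^\<^sub>m (t - j - 1) *\<^sub>v (B *\<^sub>v u j))"
proof (induction t)
  case 0 then show ?case using A x0 by simp
next
  case (Suc t)
  then have t: "t < N" by simp
  have Bu: "\<And>j. j \<le> t \<Longrightarrow> B *\<^sub>v u j \<in> carrier_vec n" using B u t by simp
  have PBu: "\<And>j k. j \<le> t \<Longrightarrow> A ^\<^sub>m k *\<^sub>v (B *\<^sub>v u j) \<in> carrier_vec n"
    using Bu A by (meson mult_mat_vec_carrier pow_carrier_mat)
  have Ax0: "\<And>k. A ^\<^sub>m k *\<^sub>v x 0 \<in> carrier_vec n"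
    using x0 A by (meson mult_mat_vec_carrier pow_carrier_mat)
  let ?S = "vsum n t (\<lambda>j. A ^\<^sub>m (t - j - 1) *\<^sub>v (B *\<^sub>v u j))"
  have S: "?S \<in> carrier_vec n" using PBu by simp
  have "A *\<^sub>v ?S = vsum n t (\<lambda>j. A *\<^sub>v (A ^\<^sub>m (t - j - 1) *\<^sub>v (B *\<^sub>v u j)))"
    using PBu by (intro mult_mat_vsum[OF A]) simp
  also have "\<dots> = vsum n t (\<lambda>j. A ^\<^sub>m (Suc t - j - 1) *\<^sub>v (B *\<^sub>v u j))"
  proof (rule vsum_cong)
    fix j assume j: "j < t"
    then have "Suc t - j - 1 = Suc (t - j - 1)" by simp
    then show "A *\<^sub>v (A ^\<^sub>m (t - j - 1) *\<^sub>v (B *\<^sub>v u j)) = A ^\<^sub>m (Suc t - j - 1) *\<^sub>v (B *\<^sub>v u j)"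
      using pow_mat_Suc_mult_vec[OF A Bu[of j], of "t - j - 1"] j by simp
  qed
  finally have AS: "A *\<^sub>v ?S = vsum n t (\<lambda>j. A ^\<^sub>m (Suc t - j - 1) *\<^sub>v (B *\<^sub>v u j))" .
  have S': "vsum n t (\<lambda>j. A ^\<^sub>m (Suc t - j - 1) *\<^sub>v (B *\<^sub>v u j)) \<in> carrier_vec n"
    using PBu by simp
  have "x (Suc t) = A *\<^sub>v (A ^\<^sub>m t *\<^sub>v x 0 + ?S) + B *\<^sub>v u t"
    using x[OF t] Suc.IH t by simp
  also have "\<dots> = (A ^\<^sub>m Suc t *\<^sub>v x 0 + A *\<^sub>v ?S) + B *\<^sub>v u t"
    by (simp only: mult_add_distrib_mat_vec[OF A Ax0 S] pow_mat_Suc_mult_vec[OF A x0])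
  also have "\<dots> = A ^\<^sub>m Suc t *\<^sub>v x 0 + (A *\<^sub>v ?S + B *\<^sub>v u t)"
    by (rule assoc_add_vec[OF Ax0 _ Bu]) (use A S in auto)
  also have "A *\<^sub>v ?S + B *\<^sub>v u t = vsum n (Suc t) (\<lambda>j. A ^\<^sub>m (Suc t - j - 1) *\<^sub>v (B *\<^sub>v u j))"
    using A B u[OF t] AS by simp
  finally show ?case .
qed

text \<open>The sum runs over the whole window and not only over the past: \<open>markov\<close>
  vanishes for future inputs, so the right-hand side uses a full block row of the Toeplitz
  matrix.\<close>

lemma output_formula:
  assumes A: "A \<in> carrier_mat n n" and B: "B \<in> carrier_mat n p"
    and C: "C \<in> carrier_mat m n" and D: "D \<in> carrier_mat m p"
    and x0: "x 0 \<in> carrier_vec n" and u: "\<And>t. t < N \<Longrightarrow> u t \<in> carrier_vec p"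
    and x: "\<And>t. Suc t < N \<Longrightarrow> x (Suc t) = A *\<^sub>v x t + B *\<^sub>v u t"
    and t: "t < N"
  shows "C *\<^sub>v x t + D *\<^sub>v u t
       = (C * A ^\<^sub>m t) *\<^sub>v x 0 + vsum m N (\<lambda>j. markov m p A B C D t j *\<^sub>v u j)"
proof -
  have Bu: "\<And>j. j < N \<Longrightarrow> B *\<^sub>v u j \<in> carrier_vec n" using B u by simp
  have PBu: "\<And>j k. j < N \<Longrightarrow> A ^\<^sub>m k *\<^sub>v (B *\<^sub>v u j) \<in> carrier_vec n"
    using Bu A by (meson mult_mat_vec_carrier pow_carrier_mat)
  have Ax0: "A ^\<^sub>m t *\<^sub>v x 0 \<in> carrier_vec n"
    using x0 A by (meson mult_mat_vec_carrier pow_carrier_mat)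
  let ?S = "vsum n t (\<lambda>j. A ^\<^sub>m (t - j - 1) *\<^sub>v (B *\<^sub>v u j))"
  have S: "?S \<in> carrier_vec n" using PBu t by simp
  have mk: "markov m p A B C D i j \<in> carrier_mat m p" for i j
    using A B C D by (auto simp: markov_def)
  have "x t = A ^\<^sub>m t *\<^sub>v x 0 + ?S"
    by (rule state_formula[where x = x and u = u and N = t, OF A B x0]) (use u x t in auto)
  then have "C *\<^sub>v x t = C *\<^sub>v (A ^\<^sub>m t *\<^sub>v x 0) + C *\<^sub>v ?S"
    using mult_add_distrib_mat_vec[OF C Ax0 S] by simp
  also have "C *\<^sub>v (A ^\<^sub>m t *\<^sub>v x 0) = (C * A ^\<^sub>m t) *\<^sub>v x 0"
    using A x0 by (intro assoc_mult_mat_vec[OF C, symmetric]) auto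
  also have "C *\<^sub>v ?S = vsum m t (\<lambda>j. markov m p A B C D t j *\<^sub>v u j)"
  proof -
    have "C *\<^sub>v ?S = vsum m t (\<lambda>j. C *\<^sub>v (A ^\<^sub>m (t - j - 1) *\<^sub>v (B *\<^sub>v u j)))"
      using PBu t by (intro mult_mat_vsum[OF C]) simp
    also have "\<dots> = vsum m t (\<lambda>j. markov m p A B C D t j *\<^sub>v u j)"
    proof (rule vsum_cong)
      fix j assume j: "j < t"
      have "(C * A ^\<^sub>m (t - j - 1)) * B *\<^sub>v u j = (C * A ^\<^sub>m (t - j - 1)) *\<^sub>v (B *\<^sub>v u j)"
        using A B C u[of j] j t by (intro assoc_mult_mat_vec) auto
      also have "\<dots> = C *\<^sub>v (A ^\<^sub>m (t - j - 1) *\<^sub>v (B *\<^sub>v u j))"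
        using A Bu[of j] j t by (intro assoc_mult_mat_vec[OF C]) auto
      finally show "C *\<^sub>v (A ^\<^sub>m (t - j - 1) *\<^sub>v (B *\<^sub>v u j)) = markov m p A B C D t j *\<^sub>v u j"
        using j by (simp add: markov_def)
    qed
    finally show ?thesis .
  qed
  finally have Cx: "C *\<^sub>v x t = (C * A ^\<^sub>m t) *\<^sub>v x 0 + vsum m t (\<lambda>j. markov m p A B C D t j *\<^sub>v u j)" .
  \<comment> \<open>The block at \<open>j = t\<close> is \<open>D\<close>; the later ones are
    zero.\<close>
  have "vsum m N (\<lambda>j. markov m p A B C D t j *\<^sub>v u j)
      = vsum m (Suc t) (\<lambda>j. markov m p A B C D t j *\<^sub>v u j)"
  proof (rule vsum_truncate)
    show "markov m p A B C D t j *\<^sub>v u j \<in> carrier_vec m" if "j < Suc t" for j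
      using that t by (intro mult_mat_vec_carrier[OF mk] u) simp
    show "markov m p A B C D t j *\<^sub>v u j = 0\<^sub>v m" if "Suc t \<le> j" "j < N" for j
      using that u[of j] by (simp add: markov_def)
  qed (use t in simp)
  also have "\<dots> = vsum m t (\<lambda>j. markov m p A B C D t j *\<^sub>v u j) + D *\<^sub>v u t"
    by (simp add: markov_def)
  finally have V: "vsum m N (\<lambda>j. markov m p A B C D t j *\<^sub>v u j)
      = vsum m t (\<lambda>j. markov m p A B C D t j *\<^sub>v u j) + D *\<^sub>v u t" .
  have c1: "(C * A ^\<^sub>m t) *\<^sub>v x 0 \<in> carrier_vec m"
    using A C x0 by (intro mult_mat_vec_carrier[of _ m n]) auto
  have c2: "vsum m t (\<lambda>j. markov m p A B C D t j *\<^sub>v u j) \<in> carrier_vec m"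
    using t u by (intro vsum_carrier mult_mat_vec_carrier[OF mk]) auto
  have c3: "D *\<^sub>v u t \<in> carrier_vec m" using D u t by auto
  show ?thesis unfolding Cx V by (rule assoc_add_vec[OF c1 c2 c3])
qed

section \<open>Stacked responses over a window\<close>

lemma obsv_mult_vec:
  assumes A: "A \<in> carrier_mat n n" and C: "C \<in> carrier_mat m n" and v: "v \<in> carrier_vec n"
  shows "obsv n m A C N *\<^sub>v v = stack m N (\<lambda>t. (C * A ^\<^sub>m t) *\<^sub>v v)"
proof -
  \<comment> \<open>Since \<open>obsv\<close> is a block column, the state is viewed as a stacked
    signal with one block.\<close>
  have "obsv n m A C N *\<^sub>v stack n 1 (\<lambda>_. v) = stack m N (\<lambda>t. vsum m 1 (\<lambda>j. (C * A ^\<^sub>m t) *\<^sub>v v))"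
    unfolding obsv_def using A C v by (intro blockmat_mult_stack) auto
  also have "\<dots> = stack m N (\<lambda>t. (C * A ^\<^sub>m t) *\<^sub>v v)"
    using A C v by (intro stack_cong) (auto simp: intro!: left_zero_vec mult_mat_vec_carrier[of _ m n])
  finally show ?thesis unfolding stack_single[OF v] .
qed

text \<open>The output formula stacked over the window: the start state enters through
  \<open>O\<close>, the input through \<open>T\<close>.\<close>

lemma toeplitz_response:
  assumes A: "A \<in> carrier_mat n n" and B: "B \<in> carrier_mat n p"
    and C: "C \<in> carrier_mat m n" and D: "D \<in> carrier_mat m p"
    and x0: "x 0 \<in> carrier_vec n" and u: "\<And>t. t < N \<Longrightarrow> u t \<in> carrier_vec p"
    and x: "\<And>t. Suc t < N \<Longrightarrow> x (Suc t) = A *\<^sub>v x t + B *\<^sub>v u t"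
  shows "stack m N (\<lambda>t. C *\<^sub>v x t + D *\<^sub>v u t)
       = obsv n m A C N *\<^sub>v x 0 + toeplitz m p A B C D N *\<^sub>v stack p N u"
proof -
  have mk: "markov m p A B C D i j \<in> carrier_mat m p" for i j
    using A B C D by (auto simp: markov_def)
  have "stack m N (\<lambda>t. C *\<^sub>v x t + D *\<^sub>v u t)
      = stack m N (\<lambda>t. (C * A ^\<^sub>m t) *\<^sub>v x 0 + vsum m N (\<lambda>j. markov m p A B C D t j *\<^sub>v u j))"
    by (rule stack_cong, rule output_formula[where x = x and u = u, OF A B C D x0 u x])
  also have "\<dots> = stack m N (\<lambda>t. (C * A ^\<^sub>m t) *\<^sub>v x 0)
      + stack m N (\<lambda>t. vsum m N (\<lambda>j. markov m p A B C D t j *\<^sub>v u j))"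
    using A C x0 u by (intro stack_add vsum_carrier mult_mat_vec_carrier[OF mk] mult_mat_vec_carrier[of _ m n]) auto
  finally show ?thesis
    using blockmat_mult_stack[of N N "markov m p A B C D" m p u] mk u
    by (simp add: toeplitz_markov obsv_mult_vec[OF A C x0])
qed

text \<open>From rest there is no free response, so the rows from \<open>a\<close> on of a longer
  Toeplitz matrix give the outputs after the first \<open>a\<close> steps. With \<open>a = n\<close>
  these are the blocks of the image representations.\<close>

lemma delayed_response:
  assumes A: "A \<in> carrier_mat n n" and B: "B \<in> carrier_mat n p"
    and C: "C \<in> carrier_mat m n" and D: "D \<in> carrier_mat m p"
    and x0: "x 0 = 0\<^sub>v n" and u: "\<And>t. t < N \<Longrightarrow> u t \<in> carrier_vec p"
    and x: "\<And>t. Suc t < N \<Longrightarrow> x (Suc t) = A *\<^sub>v x t + B *\<^sub>v u t"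
    and N: "a + s \<le> N"
  shows "blockmat m p s N (\<lambda>l j. markov m p A B C D (a + l) j) *\<^sub>v stack p N u
       = stack m s (\<lambda>l. C *\<^sub>v x (a + l) + D *\<^sub>v u (a + l))"
proof -
  have mk: "markov m p A B C D i j \<in> carrier_mat m p" for i j
    using A B C D by (auto simp: markov_def)
  have "blockmat m p s N (\<lambda>l j. markov m p A B C D (a + l) j) *\<^sub>v stack p N u
      = stack m s (\<lambda>l. vsum m N (\<lambda>j. markov m p A B C D (a + l) j *\<^sub>v u j))"
    using mk u by (intro blockmat_mult_stack) auto
  also have "\<dots> = stack m s (\<lambda>l. C *\<^sub>v x (a + l) + D *\<^sub>v u (a + l))"
  proof (rule stack_cong)
    fix l assume l: "l < s"
    have x0c: "x 0 \<in> carrier_vec n" using x0 by simp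
    have CA: "C * A ^\<^sub>m (a + l) \<in> carrier_mat m n" using A C by auto
    have "vsum m N (\<lambda>j. markov m p A B C D (a + l) j *\<^sub>v u j) \<in> carrier_vec m"
      using u by (intro vsum_carrier mult_mat_vec_carrier[OF mk]) auto
    then show "vsum m N (\<lambda>j. markov m p A B C D (a + l) j *\<^sub>v u j) = C *\<^sub>v x (a + l) + D *\<^sub>v u (a + l)"
      using output_formula[where x = x and u = u and t = "a + l", OF A B C D x0c u x] N l
      unfolding x0 mult_mat_zero_vec[OF CA] by simp
  qed
  finally show ?thesis .
qed


section \<open>Vector identities for superposition arguments\<close>

lemma vec_add_diff_cancel:
  fixes a b :: "real vec"
  assumes "a \<in> carrier_vec k" "b \<in> carrier_vec k"
  shows "a + b - b = a"
  using assms by (intro eq_vecI) auto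

lemma vec_add_diff_inverse:
  fixes a b :: "real vec"
  assumes "a \<in> carrier_vec k" "b \<in> carrier_vec k"
  shows "a + (b - a) = b"
  using assms by (intro eq_vecI) auto

lemma vec_diff_add_swap:
  fixes a b c :: "real vec"
  assumes "a \<in> carrier_vec k" "b \<in> carrier_vec k" "c \<in> carrier_vec k"
  shows "a - b + c = a + (c - b)"
  using assms by (intro eq_vecI) auto

lemma vec_add_diff_common:
  fixes a b c d :: "real vec"
  assumes "a \<in> carrier_vec k" "b \<in> carrier_vec k" "c \<in> carrier_vec k" "d \<in> carrier_vec k"
  shows "a + b + c - (d + b) = a - d + c"
  using assms by (intro eq_vecI) auto

lemma vec_split_common:
  fixes a b c d :: "real vec"
  assumes "a \<in> carrier_vec k" "b \<in> carrier_vec k" "c \<in> carrier_vec k" "d \<in> carrier_vec k"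
  shows "a + b + c = (a - d + c) + (d + b)"
  using assms by (intro eq_vecI) auto

section \<open>The factor \<open>[-T I]\<close> on trajectories\<close>

lemma kerfac_mult_append:
  assumes u: "u \<in> carrier_vec (s * p)" and y: "y \<in> carrier_vec (s * m)"
  shows "kerfac m p A B C D s *\<^sub>v (u @\<^sub>v y) = y - toeplitz m p A B C D s *\<^sub>v u"
proof (rule eq_vecI)
  let ?T = "toeplitz m p A B C D s"
  have T: "dim_row ?T = s * m" "dim_col ?T = s * p"
    by (simp_all add: toeplitz_def blockmat_def)
  show dims: "dim_vec (kerfac m p A B C D s *\<^sub>v (u @\<^sub>v y)) = dim_vec (y - ?T *\<^sub>v u)"
    using T by (simp add: kerfac_def)
  fix i assume "i < dim_vec (y - ?T *\<^sub>v u)"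
  then have i: "i < s * m" using T by simp
  have rT: "row ?T i \<in> carrier_vec (s * p)" using row_carrier[of ?T i] T(2) by simp
  have "row (kerfac m p A B C D s) i = (- row ?T i) @\<^sub>v unit_vec (s * m) i"
    using i T by (intro eq_vecI) (auto simp: kerfac_def unit_vec_def)
  moreover have "((- row ?T i) @\<^sub>v unit_vec (s * m) i) \<bullet> (u @\<^sub>v y)
      = (- row ?T i) \<bullet> u + unit_vec (s * m) i \<bullet> y"
    using rT u y by (intro scalar_prod_append[of _ "s * p" _ "s * m"]) auto
  ultimately have "(kerfac m p A B C D s *\<^sub>v (u @\<^sub>v y)) $ i = - (row ?T i \<bullet> u) + y $ i"
    using i y u T by (simp add: kerfac_def scalar_prod_uminus_left)
  then show "(kerfac m p A B C D s *\<^sub>v (u @\<^sub>v y)) $ i = (y - ?T *\<^sub>v u) $ i"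
    using i T y by simp
qed

text \<open>Isolates the last \<open>b\<close> columns of \<open>K\<close>, which later become
  \<open>K2\<close>.\<close>

lemma mult_zero_append:
  assumes K: "(K :: real mat) \<in> carrier_mat nr (a + b)" and y: "y \<in> carrier_vec b"
  shows "K *\<^sub>v (0\<^sub>v a @\<^sub>v y) = mat nr b (\<lambda>(i, j). K $$ (i, a + j)) *\<^sub>v y"
proof (rule eq_vecI)
  fix i assume "i < dim_vec (mat nr b (\<lambda>(i, j). K $$ (i, a + j)) *\<^sub>v y)"
  then have i: "i < nr" by simp
  let ?r = "row K i"
  have r: "?r \<in> carrier_vec (a + b)" using K i by auto
  have "?r = vec_first ?r a @\<^sub>v vec_last ?r b" using r by simp
  then have "?r \<bullet> (0\<^sub>v a @\<^sub>v y) = (vec_first ?r a @\<^sub>v vec_last ?r b) \<bullet> (0\<^sub>v a @\<^sub>v y)" by simp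
  also have "\<dots> = vec_last ?r b \<bullet> y"
    using y by (subst scalar_prod_append[of _ a _ b]) auto
  also have "vec_last ?r b = row (mat nr b (\<lambda>(i, j). K $$ (i, a + j))) i"
    using K i by (intro eq_vecI) (auto simp: vec_last_def)
  finally show "(K *\<^sub>v (0\<^sub>v a @\<^sub>v y)) $ i = (mat nr b (\<lambda>(i, j). K $$ (i, a + j)) *\<^sub>v y) $ i"
    using K i by simp
qed (use K in simp)

text \<open>Superposition. The factor subtracts the response to \<open>u\<close> from rest; what
  remains is the output of the error system driven by \<open>r\<close> through \<open>L\<close> and
  started at \<open>x 0\<close>.\<close>

lemma kerfac_mult_response:
  assumes A: "A \<in> carrier_mat n n" and B: "B \<in> carrier_mat n p"
    and C: "C \<in> carrier_mat m n" and D: "D \<in> carrier_mat m p" and L: "L \<in> carrier_mat n m"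
    and xc: "\<And>t. t < s \<Longrightarrow> x t \<in> carrier_vec n" and x0: "x 0 \<in> carrier_vec n"
    and u: "\<And>t. t < s \<Longrightarrow> u t \<in> carrier_vec p"
    and r: "\<And>t. t < s \<Longrightarrow> r t \<in> carrier_vec m"
    and x: "\<And>t. Suc t < s \<Longrightarrow> x (Suc t) = A *\<^sub>v x t + B *\<^sub>v u t + L *\<^sub>v r t"
  shows "kerfac m p A B C D s *\<^sub>v (stack p s u @\<^sub>v stack m s (\<lambda>t. C *\<^sub>v x t + D *\<^sub>v u t + r t))
       = obsv n m A C s *\<^sub>v x 0 + Rmat m A C L s *\<^sub>v stack m s r"
proof -
  \<comment> \<open>Same input, zero start, no residual: the output of this trajectory is exactly
    \<open>T u\<close>.\<close>
  define z where "z = traj A B (0\<^sub>v n) u"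
  have zc: "z t \<in> carrier_vec n" for t unfolding z_def using B by simp
  have z0: "z 0 = 0\<^sub>v n" and zS: "z (Suc t) = A *\<^sub>v z t + B *\<^sub>v u t" for t
    by (simp_all add: z_def)
  let ?O = "obsv n m A C s" and ?T = "toeplitz m p A B C D s" and ?R = "Rmat m A C L s"
  have "stack m s (\<lambda>t. C *\<^sub>v z t + D *\<^sub>v u t) = ?O *\<^sub>v z 0 + ?T *\<^sub>v stack p s u"
    by (rule toeplitz_response[where x = z and u = u, OF A B C D zc u zS])
  then have T: "stack m s (\<lambda>t. C *\<^sub>v z t + D *\<^sub>v u t) = ?T *\<^sub>v stack p s u"
    using mult_mat_vec_carrier[OF toeplitz_carrier stack_carrier]
    by (simp add: z0 mult_mat_zero_vec[OF obsv_carrier])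
  \<comment> \<open>In the difference the terms with \<open>B\<close> and \<open>D\<close> cancel,
    which leaves the system \<open>(A, L, C, I)\<close> with input \<open>r\<close>.\<close>
  define d where "d t = x t - z t" for t
  have dc: "d t \<in> carrier_vec n" if "t < s" for t using xc[OF that] zc unfolding d_def by simp
  have d0: "d 0 = x 0" using x0 by (simp add: d_def z0)
  have dS: "d (Suc t) = A *\<^sub>v d t + L *\<^sub>v r t" if t: "Suc t < s" for t
  proof -
    have c: "A *\<^sub>v x t \<in> carrier_vec n" "A *\<^sub>v z t \<in> carrier_vec n" "B *\<^sub>v u t \<in> carrier_vec n"
      "L *\<^sub>v r t \<in> carrier_vec n" using A B L xc[of t] zc[of t] u[of t] r[of t] t by auto
    have "A *\<^sub>v d t = A *\<^sub>v x t - A *\<^sub>v z t"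
      unfolding d_def using xc[of t] t zc by (intro mult_minus_distrib_mat_vec[OF A]) auto
    then show ?thesis
      unfolding d_def x[OF t] zS using vec_add_diff_common[OF c(1,3,4,2)] by simp
  qed
  have "stack m s (\<lambda>t. C *\<^sub>v d t + 1\<^sub>m m *\<^sub>v r t) = ?O *\<^sub>v d 0 + ?R *\<^sub>v stack m s r"
    unfolding Rmat_eq_toeplitz
    by (rule toeplitz_response[where x = d and u = r, OF A L C _ _ r dS]) (use d0 x0 in auto)
  moreover have "stack m s (\<lambda>t. C *\<^sub>v d t + 1\<^sub>m m *\<^sub>v r t) = stack m s (\<lambda>t. C *\<^sub>v d t + r t)"
    using r by (intro stack_cong) simp
  ultimately have R: "stack m s (\<lambda>t. C *\<^sub>v d t + r t) = ?O *\<^sub>v x 0 + ?R *\<^sub>v stack m s r"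
    by (simp add: d0)
  have "stack m s (\<lambda>t. C *\<^sub>v x t + D *\<^sub>v u t + r t)
      = stack m s (\<lambda>t. (C *\<^sub>v d t + r t) + (C *\<^sub>v z t + D *\<^sub>v u t))"
  proof (rule stack_cong)
    fix t assume t: "t < s"
    have c: "C *\<^sub>v x t \<in> carrier_vec m" "C *\<^sub>v z t \<in> carrier_vec m" "D *\<^sub>v u t \<in> carrier_vec m"
      "r t \<in> carrier_vec m" using C D xc[of t] zc[of t] u[of t] r[of t] t by auto
    have "C *\<^sub>v d t = C *\<^sub>v x t - C *\<^sub>v z t"
      unfolding d_def using xc[of t] t zc by (intro mult_minus_distrib_mat_vec[OF C]) auto
    then show "C *\<^sub>v x t + D *\<^sub>v u t + r t = (C *\<^sub>v d t + r t) + (C *\<^sub>v z t + D *\<^sub>v u t)"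
      using vec_split_common[OF c(1,3,4,2)] by simp
  qed
  also have "\<dots> = stack m s (\<lambda>t. C *\<^sub>v d t + r t) + stack m s (\<lambda>t. C *\<^sub>v z t + D *\<^sub>v u t)"
    using C D dc zc u r by (intro stack_add add_carrier_vec) (auto intro: mult_mat_vec_carrier)
  finally have Y: "stack m s (\<lambda>t. C *\<^sub>v x t + D *\<^sub>v u t + r t)
      = stack m s (\<lambda>t. C *\<^sub>v d t + r t) + ?T *\<^sub>v stack p s u" by (simp add: T)
  have c: "stack m s (\<lambda>t. C *\<^sub>v d t + r t) \<in> carrier_vec (s * m)"
    "?T *\<^sub>v stack p s u \<in> carrier_vec (s * m)"
    by (rule stack_carrier, rule mult_mat_vec_carrier[OF toeplitz_carrier stack_carrier])
  have "kerfac m p A B C D s *\<^sub>v (stack p s u @\<^sub>v stack m s (\<lambda>t. C *\<^sub>v x t + D *\<^sub>v u t + r t))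
      = (stack m s (\<lambda>t. C *\<^sub>v d t + r t) + ?T *\<^sub>v stack p s u) - ?T *\<^sub>v stack p s u"
    unfolding Y by (rule kerfac_mult_append[OF stack_carrier add_carrier_vec[OF c]])
  also have "\<dots> = stack m s (\<lambda>t. C *\<^sub>v d t + r t)"
    by (rule vec_add_diff_cancel[OF c])
  finally show ?thesis unfolding R .
qed

section \<open>The image representations\<close>

lemma closed_loop_carrier:
  assumes "A \<in> carrier_mat n n" "B \<in> carrier_mat n p" "F \<in> carrier_mat p n"
  shows "A + B * F \<in> carrier_mat n n"
  using assms by auto

lemma closed_loop_mult:
  assumes "(A :: real mat) \<in> carrier_mat q n" "B \<in> carrier_mat q p" "F \<in> carrier_mat p n" "v \<in> carrier_vec n"
  shows "(A + B * F) *\<^sub>v v = A *\<^sub>v v + B *\<^sub>v (F *\<^sub>v v)"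
  using assms by (subst add_mult_distrib_mat_vec[of _ q n]) auto

text \<open>The substitution \<open>u = F x + v\<close> relates closed and open loop. General
  \<open>P\<close> and \<open>Q\<close> cover the state and the output equation at once.\<close>

lemma feedback_mult:
  assumes P: "(P :: real mat) \<in> carrier_mat q n" and Q: "Q \<in> carrier_mat q p"
    and F: "F \<in> carrier_mat p n" and x: "x \<in> carrier_vec n" and v: "v \<in> carrier_vec p"
  shows "(P + Q * F) *\<^sub>v x + Q *\<^sub>v v = P *\<^sub>v x + Q *\<^sub>v (F *\<^sub>v x + v)"
proof -
  have Fx: "F *\<^sub>v x \<in> carrier_vec p" by (rule mult_mat_vec_carrier[OF F x])
  have c: "P *\<^sub>v x \<in> carrier_vec q" "Q *\<^sub>v (F *\<^sub>v x) \<in> carrier_vec q" "Q *\<^sub>v v \<in> carrier_vec q"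
    using P Q x Fx v by auto
  show ?thesis
    unfolding closed_loop_mult[OF P Q F x] mult_add_distrib_mat_vec[OF Q Fx v]
    by (rule assoc_add_vec[OF c])
qed

text \<open>\<open>M\<close> and \<open>N\<close> hold the impulse responses of the closed loop,
  with outputs \<open>u = F x + v\<close> and \<open>y\<close>; the \<open>n\<close> extra input
  blocks are the run-in before the window.\<close>

lemma IG_mult_stack:
  assumes A: "A \<in> carrier_mat n n" and B: "B \<in> carrier_mat n p"
    and C: "C \<in> carrier_mat m n" and D: "D \<in> carrier_mat m p" and F: "F \<in> carrier_mat p n"
    and x0: "x 0 = 0\<^sub>v n" and v: "\<And>t. v t \<in> carrier_vec p"
    and x: "\<And>t. x (Suc t) = (A + B * F) *\<^sub>v x t + B *\<^sub>v v t"
  shows "IG n m p A B C D F s *\<^sub>v stack p (s + n) v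
       = stack p s (\<lambda>l. F *\<^sub>v x (n + l) + v (n + l))
         @\<^sub>v stack m s (\<lambda>l. (C + D * F) *\<^sub>v x (n + l) + D *\<^sub>v v (n + l))"
proof -
  note AF = closed_loop_carrier[OF A B F]
  have CF: "C + D * F \<in> carrier_mat m n" using C D F by auto
  \<comment> \<open>The index \<open>n + l - j\<close> is an integer in the definition; its
    positive, zero and negative cases are the three cases of \<open>markov\<close> at row
    \<open>n + l\<close>.\<close>
  have M: "(\<lambda>l j. Mk p A B F (int n + int l - int j))
      = (\<lambda>l j. markov p p (A + B * F) B F (1\<^sub>m p) (n + l) j)"
    by (intro ext) (auto simp: Mk_def markov_def intro!: arg_cong2[where f = "(*)"] arg_cong2[where f = "(^\<^sub>m)"])
  have N: "(\<lambda>l j. Nk m p A B C D F (int n + int l - int j))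
      = (\<lambda>l j. markov m p (A + B * F) B (C + D * F) D (n + l) j)"
    by (intro ext) (auto simp: Nk_def markov_def intro!: arg_cong2[where f = "(*)"] arg_cong2[where f = "(^\<^sub>m)"])
  have "blockmat p p s (s + n) (\<lambda>l j. markov p p (A + B * F) B F (1\<^sub>m p) (n + l) j) *\<^sub>v stack p (s + n) v
      = stack p s (\<lambda>l. F *\<^sub>v x (n + l) + 1\<^sub>m p *\<^sub>v v (n + l))"
    by (rule delayed_response[where x = x and u = v, OF AF B F _ x0 v x]) auto
  moreover have "blockmat m p s (s + n) (\<lambda>l j. markov m p (A + B * F) B (C + D * F) D (n + l) j)
        *\<^sub>v stack p (s + n) v
      = stack m s (\<lambda>l. (C + D * F) *\<^sub>v x (n + l) + D *\<^sub>v v (n + l))"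
    by (rule delayed_response[where x = x and u = v, OF AF B CF D x0 v x]) auto
  ultimately show ?thesis
    unfolding IG_def M N mat_mult_append[OF blockmat_carrier blockmat_carrier stack_carrier]
    using v by simp
qed

text \<open>The same closed loop driven through \<open>L\<close> instead of \<open>B\<close>, with
  feedthrough zero to the control and identity to the output.\<close>

lemma IC_mult_stack:
  assumes A: "A \<in> carrier_mat n n" and B: "B \<in> carrier_mat n p"
    and C: "C \<in> carrier_mat m n" and D: "D \<in> carrier_mat m p"
    and F: "F \<in> carrier_mat p n" and L: "L \<in> carrier_mat n m"
    and x0: "x 0 = 0\<^sub>v n" and r: "\<And>t. r t \<in> carrier_vec m"
    and x: "\<And>t. x (Suc t) = (A + B * F) *\<^sub>v x t + L *\<^sub>v r t"
  shows "IC n m p A B C D F L s *\<^sub>v stack m (s + n) r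
       = stack p s (\<lambda>l. F *\<^sub>v x (n + l)) @\<^sub>v stack m s (\<lambda>l. (C + D * F) *\<^sub>v x (n + l) + r (n + l))"
proof -
  note AF = closed_loop_carrier[OF A B F]
  have CF: "C + D * F \<in> carrier_mat m n" using C D F by auto
  have Y: "(\<lambda>l j. Yk m p A B F L (int n + int l - int j))
      = (\<lambda>l j. markov p m (A + B * F) L F (0\<^sub>m p m) (n + l) j)"
    by (intro ext) (auto simp: Yk_def markov_def intro!: arg_cong2[where f = "(*)"] arg_cong2[where f = "(^\<^sub>m)"])
  have X: "(\<lambda>l j. Xk m A B C D F L (int n + int l - int j))
      = (\<lambda>l j. markov m m (A + B * F) L (C + D * F) (1\<^sub>m m) (n + l) j)"
    by (intro ext) (auto simp: Xk_def markov_def intro!: arg_cong2[where f = "(*)"] arg_cong2[where f = "(^\<^sub>m)"])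
  have xc: "x t \<in> carrier_vec n" for t
  proof (cases t)
    case (Suc k)
    then show ?thesis using L carrier_matD(1)[OF L] by (intro carrier_vecI) (simp add: x)
  qed (simp add: x0)
  have "blockmat p m s (s + n) (\<lambda>l j. markov p m (A + B * F) L F (0\<^sub>m p m) (n + l) j) *\<^sub>v stack m (s + n) r
      = stack p s (\<lambda>l. F *\<^sub>v x (n + l) + 0\<^sub>m p m *\<^sub>v r (n + l))"
    by (rule delayed_response[where x = x and u = r, OF AF L F _ x0 r x]) auto
  also have "\<dots> = stack p s (\<lambda>l. F *\<^sub>v x (n + l))"
    using r F xc by (intro stack_cong) (simp add: right_zero_vec[OF mult_mat_vec_carrier[OF F xc]])
  finally have 1: "blockmat p m s (s + n) (\<lambda>l j. markov p m (A + B * F) L F (0\<^sub>m p m) (n + l) j)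
      *\<^sub>v stack m (s + n) r = stack p s (\<lambda>l. F *\<^sub>v x (n + l))" .
  have "blockmat m m s (s + n) (\<lambda>l j. markov m m (A + B * F) L (C + D * F) (1\<^sub>m m) (n + l) j)
        *\<^sub>v stack m (s + n) r
      = stack m s (\<lambda>l. (C + D * F) *\<^sub>v x (n + l) + 1\<^sub>m m *\<^sub>v r (n + l))"
    by (rule delayed_response[where x = x and u = r, OF AF L CF _ x0 r x]) auto
  with 1 show ?thesis
    unfolding IC_def Y X mat_mult_append[OF blockmat_carrier blockmat_carrier stack_carrier]
    using r by simp
qed

section \<open>Reachable trajectories and inversion of \<open>R\<close>\<close>

lemma controllable_reach:
  assumes A: "A \<in> carrier_mat n n" and B: "B \<in> carrier_mat n p"
    and ctrl: "mrank n (ctrb n p A B) = n" and x0: "x0 \<in> carrier_vec n"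
  shows "\<exists>u. (\<forall>t. u t \<in> carrier_vec p) \<and> traj A B (0\<^sub>v n) u n = x0"
proof -
  interpret vec_space "TYPE(real)" n .
  obtain w where w: "w \<in> carrier_vec (n * p)" "ctrb n p A B *\<^sub>v w = x0"
    using full_row_rank_iff_surj[OF ctrb_carrier] ctrl x0 by blast
  let ?g = "\<lambda>j. A ^\<^sub>m j *\<^sub>v (B *\<^sub>v block p w j)"
  have Bw: "B *\<^sub>v block p w j \<in> carrier_vec n" for j
    using B by (rule mult_mat_vec_carrier) simp
  have g: "?g j \<in> carrier_vec n" for j by (rule mult_mat_vec_carrier[OF pow_carrier_mat[OF A] Bw])
  have "x0 = ctrb n p A B *\<^sub>v stack p n (block p w)" using w by (simp add: stack_block)
  also have "\<dots> = stack n 1 (\<lambda>l. vsum n n (\<lambda>j. (A ^\<^sub>m j * B) *\<^sub>v block p w j))"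
    unfolding ctrb_def using A B by (intro blockmat_mult_stack) auto
  also have "\<dots> = stack n 1 (\<lambda>l. vsum n n ?g)"
  proof (intro stack_cong vsum_cong)
    fix j
    show "(A ^\<^sub>m j * B) *\<^sub>v block p w j = ?g j"
      by (rule assoc_mult_mat_vec[OF pow_carrier_mat[OF A] B block_carrier])
  qed
  also have "\<dots> = vsum n n ?g"
    by (rule stack_single[OF vsum_carrier[OF g]])
  also have "\<dots> = vsum n n (\<lambda>j. ?g (n - 1 - j))"
    by (rule vsum_reverse[symmetric, OF g])
  finally have x0_eq: "x0 = vsum n n (\<lambda>j. ?g (n - 1 - j))" .
  \<comment> \<open>The block multiplied by the \<open>j\<close>-th power of \<open>A\<close> has to
    be applied \<open>j\<close> steps before the last input, so the blocks of \<open>w\<close> are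
    played backwards.\<close>
  define u where "u t = block p w (n - 1 - t)" for t
  have "traj A B (0\<^sub>v n) u n = A ^\<^sub>m n *\<^sub>v traj A B (0\<^sub>v n) u 0
      + vsum n n (\<lambda>j. A ^\<^sub>m (n - j - 1) *\<^sub>v (B *\<^sub>v u j))"
    by (rule state_formula[where N = n and x = "traj A B (0\<^sub>v n) u", OF A B]) (auto simp: u_def)
  also have "vsum n n (\<lambda>j. A ^\<^sub>m (n - j - 1) *\<^sub>v (B *\<^sub>v u j)) = x0"
    unfolding x0_eq u_def by simp
  also have "A ^\<^sub>m n *\<^sub>v traj A B (0\<^sub>v n) u 0 + x0 = x0"
    using mult_mat_zero_vec[OF pow_carrier_mat[OF A], of n] x0 by simp
  finally have "traj A B (0\<^sub>v n) u n = x0" .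
  moreover have "u t \<in> carrier_vec p" for t by (simp add: u_def)
  ultimately show ?thesis by blast
qed

text \<open>Invariance under feedback, made concrete: the closed loop reproduces any open-loop input
  \<open>U\<close> when fed with \<open>V = U - F X\<close>. Steering for \<open>n\<close> steps and
  then applying \<open>u\<close> gives every pair of start state and input.\<close>

lemma IG_reaches:
  assumes A: "A \<in> carrier_mat n n" and B: "B \<in> carrier_mat n p"
    and C: "C \<in> carrier_mat m n" and D: "D \<in> carrier_mat m p" and F: "F \<in> carrier_mat p n"
    and ctrl: "mrank n (ctrb n p A B) = n"
    and x0: "x0 \<in> carrier_vec n" and u: "u \<in> carrier_vec (s * p)"
  shows "\<exists>w\<in>carrier_vec ((s + n) * p). IG n m p A B C D F s *\<^sub>v w
       = u @\<^sub>v (obsv n m A C s *\<^sub>v x0 + toeplitz m p A B C D s *\<^sub>v u)"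
proof -
  obtain u0 where u0: "\<And>t. u0 t \<in> carrier_vec p" and reach: "traj A B (0\<^sub>v n) u0 n = x0"
    using controllable_reach[OF A B ctrl x0] by blast
  \<comment> \<open>The first \<open>n\<close> samples steer from rest to \<open>x0\<close>; the
    shift by \<open>n\<close> starts \<open>u\<close> at the window.\<close>
  define U where "U t = (if t < n then u0 t else block p u (t - n))" for t
  define X where "X = traj A B (0\<^sub>v n) U"
  define V where "V t = U t - F *\<^sub>v X t" for t
  have Uc: "U t \<in> carrier_vec p" for t by (simp add: U_def u0)
  have Xc: "X t \<in> carrier_vec n" for t unfolding X_def using B by simp
  have FX: "F *\<^sub>v X t \<in> carrier_vec p" for t by (rule mult_mat_vec_carrier[OF F Xc])
  have Vc: "V t \<in> carrier_vec p" for t unfolding V_def using FX by (simp add: Uc)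
  have X0: "X 0 = 0\<^sub>v n" and XS: "X (Suc t) = A *\<^sub>v X t + B *\<^sub>v U t" for t
    by (simp_all add: X_def)
  have Xn: "X n = x0"
    unfolding X_def reach[symmetric] by (rule traj_cong) (simp add: U_def)
  have UV: "F *\<^sub>v X t + V t = U t" for t
    unfolding V_def by (rule vec_add_diff_inverse[OF FX Uc])
  have split: "(P + Q * F) *\<^sub>v X t + Q *\<^sub>v V t = P *\<^sub>v X t + Q *\<^sub>v U t"
    if "P \<in> carrier_mat q n" "Q \<in> carrier_mat q p" for P Q q t
    using feedback_mult[OF that F Xc Vc, of t t] unfolding UV .
  have "IG n m p A B C D F s *\<^sub>v stack p (s + n) V
      = stack p s (\<lambda>l. F *\<^sub>v X (n + l) + V (n + l))
        @\<^sub>v stack m s (\<lambda>l. (C + D * F) *\<^sub>v X (n + l) + D *\<^sub>v V (n + l))"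
    by (rule IG_mult_stack[where x = X and v = V, OF A B C D F X0 Vc]) (simp only: XS split[OF A B])
  also have "\<dots> = stack p s (\<lambda>l. U (n + l)) @\<^sub>v stack m s (\<lambda>l. C *\<^sub>v X (n + l) + D *\<^sub>v U (n + l))"
    by (simp only: UV split[OF C D])
  also have "stack m s (\<lambda>l. C *\<^sub>v X (n + l) + D *\<^sub>v U (n + l))
      = obsv n m A C s *\<^sub>v X (n + 0) + toeplitz m p A B C D s *\<^sub>v stack p s (\<lambda>l. U (n + l))"
    by (rule toeplitz_response[where x = "\<lambda>l. X (n + l)", OF A B C D]) (simp_all add: Xc Uc XS)
  also have "stack p s (\<lambda>l. U (n + l)) = u"
    using stack_block[OF u] by (simp add: U_def cong: stack_cong)
  finally show ?thesis
    by (intro bexI[of _ "stack p (s + n) V"]) (simp_all add: Xn)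
qed

text \<open>The preimage is simulated by the observer \<open>d\<^sup>+ = (A - L C) d + L z\<close> with residual \<open>z - C d\<close>.\<close>
lemma Rmat_surj:
  assumes A: "A \<in> carrier_mat n n" and C: "C \<in> carrier_mat m n" and L: "L \<in> carrier_mat n m"
    and z: "z \<in> carrier_vec (s * m)"
  shows "\<exists>w\<in>carrier_vec (s * m). Rmat m A C L s *\<^sub>v w = z"
proof -
  define d where "d = traj (A - L * C) L (0\<^sub>v n) (block m z)"
  define r where "r t = block m z t - C *\<^sub>v d t" for t
  have dc: "d t \<in> carrier_vec n" for t unfolding d_def using L by simp
  have Cd: "C *\<^sub>v d t \<in> carrier_vec m" for t by (rule mult_mat_vec_carrier[OF C dc])
  have rc: "r t \<in> carrier_vec m" for t unfolding r_def using Cd by simp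
  have d0: "d 0 = 0\<^sub>v n" by (simp add: d_def)
  \<comment> \<open>Substituting \<open>L z = L r + L C d\<close> cancels the observer correction,
    so \<open>d\<close> also obeys the error system with input \<open>r\<close>.\<close>
  have dS: "d (Suc t) = A *\<^sub>v d t + L *\<^sub>v r t" for t
  proof -
    have c: "A *\<^sub>v d t \<in> carrier_vec n" "L *\<^sub>v (C *\<^sub>v d t) \<in> carrier_vec n" "L *\<^sub>v block m z t \<in> carrier_vec n"
      using A L dc Cd by auto
    have "d (Suc t) = (A - L * C) *\<^sub>v d t + L *\<^sub>v block m z t" by (simp add: d_def)
    also have "(A - L * C) *\<^sub>v d t = A *\<^sub>v d t - L *\<^sub>v (C *\<^sub>v d t)"
      using A L C dc by (subst minus_mult_distrib_mat_vec[of _ n n]) auto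
    finally show ?thesis
      unfolding r_def mult_minus_distrib_mat_vec[OF L block_carrier Cd]
      by (rule trans[OF _ vec_diff_add_swap[OF c]])
  qed
  have "stack m s (\<lambda>t. C *\<^sub>v d t + 1\<^sub>m m *\<^sub>v r t) = obsv n m A C s *\<^sub>v d 0 + Rmat m A C L s *\<^sub>v stack m s r"
    unfolding Rmat_eq_toeplitz by (rule toeplitz_response[where x = d and u = r, OF A L C _ dc rc dS]) simp
  also have "\<dots> = Rmat m A C L s *\<^sub>v stack m s r"
    unfolding d0 mult_mat_zero_vec[OF obsv_carrier]
    by (rule left_zero_vec[OF mult_mat_vec_carrier[OF Rmat_carrier stack_carrier]])
  also have "stack m s (\<lambda>t. C *\<^sub>v d t + 1\<^sub>m m *\<^sub>v r t) = stack m s (block m z)"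
  proof (rule stack_cong)
    fix t
    show "C *\<^sub>v d t + 1\<^sub>m m *\<^sub>v r t = block m z t"
      unfolding one_mult_mat_vec[OF rc] unfolding r_def by (rule vec_add_diff_inverse[OF Cd block_carrier])
  qed
  finally show ?thesis
    using stack_block[OF z] by (intro bexI[of _ "stack m s r"]) simp_all
qed


section \<open>The factor applied to images, and delayed residuals\<close>

lemma kerfac_mult_IG:
  assumes A: "A \<in> carrier_mat n n" and B: "B \<in> carrier_mat n p"
    and C: "C \<in> carrier_mat m n" and D: "D \<in> carrier_mat m p" and F: "F \<in> carrier_mat p n"
    and w: "w \<in> carrier_vec ((s + n) * p)"
  shows "\<exists>x0\<in>carrier_vec n.
    kerfac m p A B C D s *\<^sub>v (IG n m p A B C D F s *\<^sub>v w) = obsv n m A C s *\<^sub>v x0"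
proof -
  define V where "V = block p w"
  define X where "X = traj (A + B * F) B (0\<^sub>v n) V"
  \<comment> \<open>The actual control input. In terms of it the trajectory is an open-loop one with
    zero residual, so the factor leaves only \<open>O\<close> applied to \<open>X n\<close>.\<close>
  define U where "U t = F *\<^sub>v X t + V t" for t
  have Vc: "V t \<in> carrier_vec p" for t by (simp add: V_def)
  have Xc: "X t \<in> carrier_vec n" for t unfolding X_def using B by simp
  have Uc: "U t \<in> carrier_vec p" for t unfolding U_def by (rule add_carrier_vec[OF mult_mat_vec_carrier[OF F Xc] Vc])
  have X0: "X 0 = 0\<^sub>v n" and XS: "X (Suc t) = (A + B * F) *\<^sub>v X t + B *\<^sub>v V t" for t
    by (simp_all add: X_def)
  have XU: "X (Suc t) = A *\<^sub>v X t + B *\<^sub>v U t" for t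
    unfolding XS U_def by (rule feedback_mult[OF A B F Xc Vc])
  let ?U = "stack p s (\<lambda>l. U (n + l))" and ?O = "obsv n m A C s" and ?T = "toeplitz m p A B C D s"
  have "IG n m p A B C D F s *\<^sub>v w
      = ?U @\<^sub>v stack m s (\<lambda>l. (C + D * F) *\<^sub>v X (n + l) + D *\<^sub>v V (n + l))"
    using IG_mult_stack[where x = X and v = V and s = s, OF A B C D F X0 Vc XS] stack_block[OF w]
    by (simp add: V_def U_def)
  also have "(\<lambda>l. (C + D * F) *\<^sub>v X (n + l) + D *\<^sub>v V (n + l)) = (\<lambda>l. C *\<^sub>v X (n + l) + D *\<^sub>v U (n + l))"
    unfolding U_def feedback_mult[OF C D F Xc Vc] ..
  also have "stack m s \<dots> = ?O *\<^sub>v X (n + 0) + ?T *\<^sub>v ?U"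
    by (rule toeplitz_response[where x = "\<lambda>l. X (n + l)", OF A B C D]) (simp_all add: Xc Uc XU)
  finally have IG: "IG n m p A B C D F s *\<^sub>v w = ?U @\<^sub>v (?O *\<^sub>v X n + ?T *\<^sub>v ?U)" by simp
  have c: "?O *\<^sub>v X n \<in> carrier_vec (s * m)" "?T *\<^sub>v ?U \<in> carrier_vec (s * m)"
    by (rule mult_mat_vec_carrier[OF obsv_carrier Xc],
        rule mult_mat_vec_carrier[OF toeplitz_carrier stack_carrier])
  have "kerfac m p A B C D s *\<^sub>v (IG n m p A B C D F s *\<^sub>v w) = ?O *\<^sub>v X n"
    unfolding IG kerfac_mult_append[OF stack_carrier add_carrier_vec[OF c]]
    by (rule vec_add_diff_cancel[OF c])
  then show ?thesis using Xc by blast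
qed

text \<open>The image is a trajectory of the kernel-based model with control \<open>u = F x\<close>.
  Residuals before the window survive only in its start state, hence the existential
  \<open>x0\<close>.\<close>

lemma kerfac_mult_IC:
  assumes A: "A \<in> carrier_mat n n" and B: "B \<in> carrier_mat n p"
    and C: "C \<in> carrier_mat m n" and D: "D \<in> carrier_mat m p"
    and F: "F \<in> carrier_mat p n" and L: "L \<in> carrier_mat n m"
    and r: "\<And>t. r t \<in> carrier_vec m"
  shows "\<exists>x0\<in>carrier_vec n.
    kerfac m p A B C D s *\<^sub>v (IC n m p A B C D F L s *\<^sub>v stack m (s + n) r)
    = obsv n m A C s *\<^sub>v x0 + Rmat m A C L s *\<^sub>v stack m s (\<lambda>l. r (n + l))"
proof -
  define X where "X = traj (A + B * F) L (0\<^sub>v n) r"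
  have Xc: "X t \<in> carrier_vec n" for t unfolding X_def using L by simp
  have X0: "X 0 = 0\<^sub>v n" and XS: "X (Suc t) = (A + B * F) *\<^sub>v X t + L *\<^sub>v r t" for t
    by (simp_all add: X_def)
  have FX: "F *\<^sub>v X t \<in> carrier_vec p" for t by (rule mult_mat_vec_carrier[OF F Xc])
  have "kerfac m p A B C D s *\<^sub>v (stack p s (\<lambda>l. F *\<^sub>v X (n + l))
        @\<^sub>v stack m s (\<lambda>l. C *\<^sub>v X (n + l) + D *\<^sub>v (F *\<^sub>v X (n + l)) + r (n + l)))
      = obsv n m A C s *\<^sub>v X (n + 0) + Rmat m A C L s *\<^sub>v stack m s (\<lambda>l. r (n + l))"
    by (rule kerfac_mult_response[where x = "\<lambda>l. X (n + l)", OF A B C D L])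
      (simp_all add: Xc FX r XS closed_loop_mult[OF A B F Xc])
  then show ?thesis
    unfolding IC_mult_stack[where x = X and r = r, OF A B C D F L X0 r XS] closed_loop_mult[OF C D F Xc]
    using Xc by auto
qed

text \<open>Residuals before time \<open>a\<close> act on later rows only through the state reached
  at time \<open>a\<close>. The tail thus differs from the windowed \<open>R r\<close> by an element
  of the range of \<open>O\<close>, which \<open>K2\<close> annihilates.\<close>

lemma Rmat_delayed_residual:
  assumes A: "A \<in> carrier_mat n n" and C: "C \<in> carrier_mat m n" and L: "L \<in> carrier_mat n m"
    and r: "\<And>t. t < s + a \<Longrightarrow> r t \<in> carrier_vec m"
  shows "\<exists>x0\<in>carrier_vec n.
    vec (s * m) (\<lambda>i. (Rmat m A C L (s + a) *\<^sub>v stack m (s + a) r) $ (a * m + i))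
    = obsv n m A C s *\<^sub>v x0 + Rmat m A C L s *\<^sub>v stack m s (\<lambda>l. r (a + l))"
proof -
  define d where "d = traj A L (0\<^sub>v n) r"
  have dc: "d t \<in> carrier_vec n" for t unfolding d_def using L by simp
  have d0: "d 0 = 0\<^sub>v n" and dS: "d (Suc t) = A *\<^sub>v d t + L *\<^sub>v r t" for t
    by (simp_all add: d_def)
  let ?y = "\<lambda>t. C *\<^sub>v d t + 1\<^sub>m m *\<^sub>v r t"
  have "stack m (s + a) ?y = obsv n m A C (s + a) *\<^sub>v d 0 + Rmat m A C L (s + a) *\<^sub>v stack m (s + a) r"
    unfolding Rmat_eq_toeplitz by (rule toeplitz_response[where x = d and u = r, OF A L C _ dc r dS]) simp
  then have "Rmat m A C L (s + a) *\<^sub>v stack m (s + a) r = stack m (s + a) ?y"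
    unfolding d0 mult_mat_zero_vec[OF obsv_carrier]
    by (simp add: left_zero_vec[OF mult_mat_vec_carrier[OF Rmat_carrier stack_carrier]])
  moreover have "vec (s * m) (\<lambda>i. stack m (s + a) ?y $ (a * m + i)) = stack m s (\<lambda>l. ?y (a + l))"
  proof (intro eq_vecI)
    fix i assume "i < dim_vec (stack m s (\<lambda>l. ?y (a + l)))"
    then have i: "i < s * m" by (simp add: stack_def)
    then have "m > 0" by (cases m) auto
    then have "(a * m + i) div m = a + i div m" "(a * m + i) mod m = i mod m" by simp_all
    moreover have "a * m + i < (s + a) * m" using i by (simp add: algebra_simps)
    ultimately show "vec (s * m) (\<lambda>i. stack m (s + a) ?y $ (a * m + i)) $ i = stack m s (\<lambda>l. ?y (a + l)) $ i"
      using i unfolding stack_def by simp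
  qed (simp add: stack_def)
  moreover have "stack m s (\<lambda>l. ?y (a + l))
      = obsv n m A C s *\<^sub>v d (a + 0) + Rmat m A C L s *\<^sub>v stack m s (\<lambda>l. r (a + l))"
    unfolding Rmat_eq_toeplitz
    by (rule toeplitz_response[where x = "\<lambda>l. d (a + l)" and u = "\<lambda>l. r (a + l)", OF A L C])
      (simp_all add: dc r dS)
  ultimately show ?thesis using dc by auto
qed

section \<open>The kernel representation theorem\<close>

theorem theorem4:
  fixes n m p s :: nat and A B C D F L K :: "real mat"
  assumes "n \<ge> 1"
    and A: "A \<in> carrier_mat n n" and B: "B \<in> carrier_mat n p"
    and C: "C \<in> carrier_mat m n" and D: "D \<in> carrier_mat m p"
    and ctrl: "mrank n (ctrb n p A B) = n"
    and obs: "mrank (n * m) (obsv n m A C n) = n"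
    and s: "s > mu_obs n m A C"
    and F: "F \<in> carrier_mat p n" and L: "L \<in> carrier_mat n m"
    and K: "K \<in> carrier_mat (s * m - n) (s * (p + m))"
  shows "((K * IG n m p A B C D F s = 0\<^sub>m (s * m - n) ((s + n) * p) \<and>
          mrank (s * m - n) (K * IC n m p A B C D F L s) = s * m - n)
       \<longleftrightarrow> (\<exists>K2 \<in> carrier_mat (s * m - n) (s * m).
             K = K2 * kerfac m p A B C D s \<and>
             K2 * obsv n m A C s = 0\<^sub>m (s * m - n) n \<and>
             mrank (s * m - n) K2 = s * m - n)) \<and>
       (\<forall>K2 \<in> carrier_mat (s * m - n) (s * m).
           K = K2 * kerfac m p A B C D s \<and>
           K2 * obsv n m A C s = 0\<^sub>m (s * m - n) n \<and>
           mrank (s * m - n) K2 = s * m - n \<longrightarrow>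
           (\<forall>u y r xh I k.
              int_interval I \<and> {k - int n + 1 .. k + int s} \<subseteq> I \<and>
              (\<forall>j\<in>I. u j \<in> carrier_vec p \<and> y j \<in> carrier_vec m \<and>
                      r j \<in> carrier_vec m \<and> xh j \<in> carrier_vec n) \<and>
              kbm_solution A B C D L u y r xh I \<longrightarrow>
              K *\<^sub>v (stackv p s u k @\<^sub>v stackv m s y k) =
              K2 *\<^sub>v vec (s * m) (\<lambda>i. (Rmat m A C L (s + n) *\<^sub>v stackv m (s + n) r (k - int n)) $ (n * m + i))))"
proof -
  let ?\<theta> = "s * m - n"
  let ?T = "toeplitz m p A B C D s" and ?O = "obsv n m A C s" and ?R = "Rmat m A C L s"
    and ?H = "kerfac m p A B C D s" and ?IG = "IG n m p A B C D F s" and ?IC = "IC n m p A B C D F L s"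
  \<comment> \<open>The rank condition is left out on purpose: vanishing of \<open>K * IG\<close> is
    equivalent to the existence of such a factor, and the two rank conditions are then compared for
    any given factor.\<close>
  define factors where "factors K2 \<longleftrightarrow> K = K2 * ?H \<and> K2 * ?O = 0\<^sub>m ?\<theta> n" for K2
  have Kc: "K \<in> carrier_mat ?\<theta> (s * p + s * m)" using K by (simp add: distrib_left)
  note surj_iff = vec_space.full_row_rank_iff_surj
  have K_mult: "K *\<^sub>v v = K2 *\<^sub>v (?H *\<^sub>v v)"
    if "K2 \<in> carrier_mat ?\<theta> (s * m)" "factors K2" "v \<in> carrier_vec (s * p + s * m)" for K2 v
    using that assoc_mult_mat_vec[OF that(1) kerfac_carrier that(3)] by (simp add: factors_def)
  have K2_O: "K2 *\<^sub>v (?O *\<^sub>v x) = 0\<^sub>v ?\<theta>"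
    if "K2 \<in> carrier_mat ?\<theta> (s * m)" "factors K2" "x \<in> carrier_vec n" for K2 x
    using that assoc_mult_mat_vec[OF that(1) obsv_carrier that(3), symmetric] by (simp add: factors_def)
  \<comment> \<open>Start states are invisible after \<open>K2\<close>; this is why the preceding
    lemmas may leave them existential.\<close>
  have K2_O_add: "K2 *\<^sub>v (?O *\<^sub>v x + z) = K2 *\<^sub>v z"
    if "K2 \<in> carrier_mat ?\<theta> (s * m)" "factors K2" "x \<in> carrier_vec n" "z \<in> carrier_vec (s * m)" for K2 x z
    using mult_add_distrib_mat_vec[OF that(1) mult_mat_vec_carrier[OF obsv_carrier that(3)] that(4)]
      K2_O[OF that(1-3)] mult_mat_vec_carrier[OF that(1) that(4)] by simp
  have K_IC: "(K * ?IC) *\<^sub>v stack m (s + n) r = K2 *\<^sub>v (?R *\<^sub>v stack m s (\<lambda>l. r (n + l)))"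
    if K2: "K2 \<in> carrier_mat ?\<theta> (s * m)" "factors K2" and r: "\<And>t. r t \<in> carrier_vec m" for K2 r
  proof -
    obtain x0 where x0: "x0 \<in> carrier_vec n"
      "?H *\<^sub>v (?IC *\<^sub>v stack m (s + n) r) = ?O *\<^sub>v x0 + ?R *\<^sub>v stack m s (\<lambda>l. r (n + l))"
      using kerfac_mult_IC[where r = r, OF A B C D F L r] by blast
    have "(K * ?IC) *\<^sub>v stack m (s + n) r = K *\<^sub>v (?IC *\<^sub>v stack m (s + n) r)"
      by (rule assoc_mult_mat_vec[OF Kc IC_carrier stack_carrier])
    also have "\<dots> = K2 *\<^sub>v (?O *\<^sub>v x0 + ?R *\<^sub>v stack m s (\<lambda>l. r (n + l)))"
      unfolding K_mult[OF K2 mult_mat_vec_carrier[OF IC_carrier stack_carrier]] x0(2) ..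
    also have "\<dots> = K2 *\<^sub>v (?R *\<^sub>v stack m s (\<lambda>l. r (n + l)))"
      by (rule K2_O_add[OF K2 x0(1) mult_mat_vec_carrier[OF Rmat_carrier stack_carrier]])
    finally show ?thesis .
  qed
  have IG_zero_iff: "K * ?IG = 0\<^sub>m ?\<theta> ((s + n) * p) \<longleftrightarrow> (\<exists>K2\<in>carrier_mat ?\<theta> (s * m). factors K2)"
  proof
    assume zero: "K * ?IG = 0\<^sub>m ?\<theta> ((s + n) * p)"
    \<comment> \<open>Every residual-free trajectory is annihilated by \<open>K\<close>, since
      \<open>IG_reaches\<close> makes it a value of \<open>IG\<close>.\<close>
    have K_resp: "K *\<^sub>v (u @\<^sub>v (?O *\<^sub>v x0 + ?T *\<^sub>v u)) = 0\<^sub>v ?\<theta>"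
      if u: "u \<in> carrier_vec (s * p)" and x0: "x0 \<in> carrier_vec n" for u x0
    proof -
      obtain w where w: "w \<in> carrier_vec ((s + n) * p)" "?IG *\<^sub>v w = u @\<^sub>v (?O *\<^sub>v x0 + ?T *\<^sub>v u)"
        using IG_reaches[OF A B C D F ctrl x0 u] by blast
      show ?thesis
        using assoc_mult_mat_vec[OF Kc IG_carrier w(1), of A B C D F] w by (simp add: zero)
    qed
    \<comment> \<open>This choice is forced, because the last block of \<open>[-T I]\<close> is the
      identity.\<close>
    define K2 where "K2 = mat ?\<theta> (s * m) (\<lambda>(i, j). K $$ (i, s * p + j))"
    have K2: "K2 \<in> carrier_mat ?\<theta> (s * m)" by (simp add: K2_def)
    have K2_mult: "K *\<^sub>v (0\<^sub>v (s * p) @\<^sub>v y) = K2 *\<^sub>v y" if "y \<in> carrier_vec (s * m)" for y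
      unfolding K2_def by (rule mult_zero_append[OF Kc that])
    have "K2 * ?O = 0\<^sub>m ?\<theta> n"
    proof (rule mat_eqI_mult_vec)
      fix x :: "real vec" assume x: "x \<in> carrier_vec n"
      have Ox: "?O *\<^sub>v x \<in> carrier_vec (s * m)" by (rule mult_mat_vec_carrier[OF obsv_carrier x])
      have "(K2 * ?O) *\<^sub>v x = K2 *\<^sub>v (?O *\<^sub>v x)" by (rule assoc_mult_mat_vec[OF K2 obsv_carrier x])
      \<comment> \<open>The trajectory with zero input and start state \<open>x\<close> has stacked
        output \<open>O x\<close>.\<close>
      also have "\<dots> = 0\<^sub>v ?\<theta>"
        using K_resp[OF zero_carrier_vec x] K2_mult[OF Ox] Ox
        by (simp add: mult_mat_zero_vec[OF toeplitz_carrier])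
      finally show "(K2 * ?O) *\<^sub>v x = 0\<^sub>m ?\<theta> n *\<^sub>v x" using x by simp
    qed (use K2 in \<open>auto intro: mult_carrier_mat[OF _ obsv_carrier]\<close>)
    moreover have "K = K2 * ?H"
    proof (rule mat_eqI_mult_vec[OF Kc mult_carrier_mat[OF K2 kerfac_carrier]])
      fix v :: "real vec" assume v: "v \<in> carrier_vec (s * p + s * m)"
      define u where "u = vec_first v (s * p)"
      define y where "y = vec_last v (s * m)"
      have u: "u \<in> carrier_vec (s * p)" and y: "y \<in> carrier_vec (s * m)"
        by (simp_all add: u_def y_def)
      have v_eq: "v = u @\<^sub>v y" using v by (simp add: u_def y_def)
      have Tu: "?T *\<^sub>v u \<in> carrier_vec (s * m)" by (rule mult_mat_vec_carrier[OF toeplitz_carrier u])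
      have yT: "y - ?T *\<^sub>v u \<in> carrier_vec (s * m)" using y Tu by simp
      \<comment> \<open>Zero-state response to \<open>u\<close> plus a pure output deviation:
        \<open>K\<close> kills the first part and acts as \<open>K2\<close> on the second, whose
        output component is \<open>[-T I] v\<close>.\<close>
      have "v = (u @\<^sub>v ?T *\<^sub>v u) + (0\<^sub>v (s * p) @\<^sub>v (y - ?T *\<^sub>v u))"
        unfolding v_eq append_vec_add[OF u zero_carrier_vec Tu yT] vec_add_diff_inverse[OF Tu y]
        using u by simp
      then have "K *\<^sub>v v = K *\<^sub>v (u @\<^sub>v ?T *\<^sub>v u) + K *\<^sub>v (0\<^sub>v (s * p) @\<^sub>v (y - ?T *\<^sub>v u))"
        using mult_add_distrib_mat_vec[OF Kc, of "u @\<^sub>v ?T *\<^sub>v u" "0\<^sub>v (s * p) @\<^sub>v (y - ?T *\<^sub>v u)"]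
          u Tu yT by simp
      also have "K *\<^sub>v (u @\<^sub>v ?T *\<^sub>v u) = 0\<^sub>v ?\<theta>"
        using K_resp[OF u zero_carrier_vec] Tu by (simp add: mult_mat_zero_vec[OF obsv_carrier])
      also have "0\<^sub>v ?\<theta> + K *\<^sub>v (0\<^sub>v (s * p) @\<^sub>v (y - ?T *\<^sub>v u)) = K2 *\<^sub>v (?H *\<^sub>v v)"
        unfolding K2_mult[OF yT] v_eq kerfac_mult_append[OF u y]
        by (rule left_zero_vec[OF mult_mat_vec_carrier[OF K2 yT]])
      also have "\<dots> = (K2 * ?H) *\<^sub>v v" by (rule assoc_mult_mat_vec[OF K2 kerfac_carrier v, symmetric])
      finally show "K *\<^sub>v v = (K2 * ?H) *\<^sub>v v" .
    qed
    ultimately show "\<exists>K2\<in>carrier_mat ?\<theta> (s * m). factors K2" using K2 by (auto simp: factors_def)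
  next
    assume "\<exists>K2\<in>carrier_mat ?\<theta> (s * m). factors K2"
    then obtain K2 where K2: "K2 \<in> carrier_mat ?\<theta> (s * m)" "factors K2" by blast
    show "K * ?IG = 0\<^sub>m ?\<theta> ((s + n) * p)"
    proof (rule mat_eqI_mult_vec[OF mult_carrier_mat[OF Kc IG_carrier] zero_carrier_mat])
      fix w :: "real vec" assume w: "w \<in> carrier_vec ((s + n) * p)"
      obtain x0 where x0: "x0 \<in> carrier_vec n" "?H *\<^sub>v (?IG *\<^sub>v w) = ?O *\<^sub>v x0"
        using kerfac_mult_IG[OF A B C D F w] by blast
      have "(K * ?IG) *\<^sub>v w = K *\<^sub>v (?IG *\<^sub>v w)" by (rule assoc_mult_mat_vec[OF Kc IG_carrier w])
      also have "\<dots> = 0\<^sub>v ?\<theta>"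
        unfolding K_mult[OF K2 mult_mat_vec_carrier[OF IG_carrier w]] x0(2) by (rule K2_O[OF K2 x0(1)])
      finally show "(K * ?IG) *\<^sub>v w = 0\<^sub>m ?\<theta> ((s + n) * p) *\<^sub>v w" using w by simp
    qed
  qed
  have rank_iff: "mrank ?\<theta> (K * ?IC) = ?\<theta> \<longleftrightarrow> mrank ?\<theta> K2 = ?\<theta>"
    if K2: "K2 \<in> carrier_mat ?\<theta> (s * m)" "factors K2" for K2
  proof -
    have "(\<forall>b\<in>carrier_vec ?\<theta>. \<exists>w\<in>carrier_vec ((s + n) * m). (K * ?IC) *\<^sub>v w = b)
      \<longleftrightarrow> (\<forall>b\<in>carrier_vec ?\<theta>. \<exists>z\<in>carrier_vec (s * m). K2 *\<^sub>v z = b)"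
    proof (intro ball_cong refl iffI)
      fix b assume "\<exists>w\<in>carrier_vec ((s + n) * m). (K * ?IC) *\<^sub>v w = b"
      then obtain w where w: "w \<in> carrier_vec ((s + n) * m)" "(K * ?IC) *\<^sub>v w = b" by blast
      \<comment> \<open>The first \<open>n\<close> blocks of \<open>w\<close> precede the window and
        drop out.\<close>
      have "K2 *\<^sub>v (?R *\<^sub>v stack m s (\<lambda>l. block m w (n + l))) = b"
        using K_IC[where r = "block m w", OF K2 block_carrier] unfolding stack_block[OF w(1)] w(2) ..
      then show "\<exists>z\<in>carrier_vec (s * m). K2 *\<^sub>v z = b"
        using mult_mat_vec_carrier[OF Rmat_carrier stack_carrier] by blast
    next
      fix b assume "\<exists>z\<in>carrier_vec (s * m). K2 *\<^sub>v z = b"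
      then obtain z where z: "z \<in> carrier_vec (s * m)" "K2 *\<^sub>v z = b" by blast
      obtain v where v: "v \<in> carrier_vec (s * m)" "?R *\<^sub>v v = z" using Rmat_surj[OF A C L z(1)] by blast
      \<comment> \<open>Truncated subtraction repeats block \<open>0\<close> for
        \<open>t < n\<close>; these samples precede the window and do not affect the result.\<close>
      have "(K * ?IC) *\<^sub>v stack m (s + n) (\<lambda>t. block m v (t - n))
          = K2 *\<^sub>v (?R *\<^sub>v stack m s (\<lambda>l. block m v (n + l - n)))"
        by (rule K_IC[where r = "\<lambda>t. block m v (t - n)", OF K2 block_carrier])
      also have "\<dots> = b" using stack_block[OF v(1)] v(2) z(2) by simp
      finally show "\<exists>w\<in>carrier_vec ((s + n) * m). (K * ?IC) *\<^sub>v w = b" using stack_carrier by blast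
    qed
    then show ?thesis
      unfolding surj_iff[OF mult_carrier_mat[OF Kc IC_carrier]] surj_iff[OF K2(1)] .
  qed
  have residual: "K *\<^sub>v (stackv p s u k @\<^sub>v stackv m s y k)
      = K2 *\<^sub>v vec (s * m) (\<lambda>i. (Rmat m A C L (s + n) *\<^sub>v stackv m (s + n) r (k - int n)) $ (n * m + i))"
    if K2: "K2 \<in> carrier_mat ?\<theta> (s * m)" "factors K2"
      and I: "{k - int n + 1 .. k + int s} \<subseteq> I"
      and cI: "\<forall>j\<in>I. u j \<in> carrier_vec p \<and> y j \<in> carrier_vec m \<and> r j \<in> carrier_vec m \<and> xh j \<in> carrier_vec n"
      and sol: "kbm_solution A B C D L u y r xh I"
    for K2 u y r xh I k
  proof -
    have inI: "k + 1 + int t \<in> I" if "t < s" for t using that I by auto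
    have xS: "xh (k + 1 + int (Suc t)) = A *\<^sub>v xh (k + 1 + int t) + B *\<^sub>v u (k + 1 + int t) + L *\<^sub>v r (k + 1 + int t)"
      if t: "Suc t < s" for t
    proof -
      have e: "k + 1 + int (Suc t) = (k + 1 + int t) + 1" by simp
      show ?thesis
        using sol inI[of t] inI[of "Suc t"] Suc_lessD[OF t] t unfolding e kbm_solution_def by blast
    qed
    have r': "r (k - int n + 1 + int t) \<in> carrier_vec m" if "t < s + n" for t
    proof -
      have "k - int n + 1 + int t \<in> I" using that by (intro subsetD[OF I]) simp
      then show ?thesis using cI by blast
    qed
    let ?r = "stack m s (\<lambda>t. r (k + 1 + int t))"
    have Rr: "?R *\<^sub>v ?r \<in> carrier_vec (s * m)" by (rule mult_mat_vec_carrier[OF Rmat_carrier stack_carrier])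
    have shift: "(\<lambda>l. r (k - int n + 1 + int (n + l))) = (\<lambda>l. r (k + 1 + int l))"
      by (intro ext arg_cong[where f = r]) simp
    \<comment> \<open>The state \<open>x1\<close> carries the effect of the residuals before the
      window; in general it differs from the model state at time \<open>k + 1\<close>.\<close>
    obtain x1 where x1: "x1 \<in> carrier_vec n"
      "vec (s * m) (\<lambda>i. (Rmat m A C L (s + n) *\<^sub>v stackv m (s + n) r (k - int n)) $ (n * m + i))
       = ?O *\<^sub>v x1 + ?R *\<^sub>v ?r"
      using Rmat_delayed_residual[where r = "\<lambda>t. r (k - int n + 1 + int t)" and s = s and a = n, OF A C L r']
      unfolding stackv_eq_stack shift by blast
    \<comment> \<open>From \<open>s > mu_obs\<close> follows \<open>s > 0\<close>, so time
      \<open>k + 1\<close> lies in the window.\<close>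
    have x0: "xh (k + 1 + int 0) \<in> carrier_vec n" using cI inI[OF le_less_trans[OF le0 s]] by blast
    have "stackv m s y k = stack m s (\<lambda>t. C *\<^sub>v xh (k + 1 + int t) + D *\<^sub>v u (k + 1 + int t) + r (k + 1 + int t))"
      unfolding stackv_eq_stack using sol inI by (intro stack_cong) (simp add: kbm_solution_def)
    then have "?H *\<^sub>v (stackv p s u k @\<^sub>v stackv m s y k) = ?O *\<^sub>v xh (k + 1 + int 0) + ?R *\<^sub>v ?r"
      unfolding stackv_eq_stack
      using kerfac_mult_response[where x = "\<lambda>t. xh (k + 1 + int t)" and u = "\<lambda>t. u (k + 1 + int t)"
          and r = "\<lambda>t. r (k + 1 + int t)", OF A B C D L _ x0 _ _ xS] cI inI by simp
    moreover have "stackv p s u k @\<^sub>v stackv m s y k \<in> carrier_vec (s * p + s * m)"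
      by (simp add: stackv_eq_stack)
    ultimately have "K *\<^sub>v (stackv p s u k @\<^sub>v stackv m s y k) = K2 *\<^sub>v (?O *\<^sub>v xh (k + 1 + int 0) + ?R *\<^sub>v ?r)"
      using K_mult[OF K2] by simp
    \<comment> \<open>Possibly different start states but the same \<open>R r\<close>:
      \<open>K2\<close> removes both states, and the two sides agree.\<close>
    then show ?thesis unfolding x1(2) K2_O_add[OF K2 x1(1) Rr] K2_O_add[OF K2 x0 Rr] .
  qed
  show ?thesis
    using IG_zero_iff rank_iff residual unfolding factors_def by blast
qed

end
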